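(* Assume: (A1) $X\subset\mathbb{R}^d$ is a nonempty closed convex set onto which the projection can be easily computed; (A2) $f:\mathbb{R}^d\to\mathbb{R}$, $f(\mathbf{x}):=\mathbb{E}[F(\mathbf{x},\boldsymbol{\xi})]$, is well defined, where $F(\cdot,\boldsymbol{\xi})$ is continuously differentiable for almost every $\boldsymbol{\xi}\in\Xi$; (A3) $h_{n+1,i}\ge h_{n,i}$ almost surely for all $n\in\mathbb{N}$ and all $i=1,\dots,d$; (A4) for all $i=1,\dots,d$ there is a positive number $B_i$ with $\sup\{\mathbb{E}[h_{n,i}]:n\in\mathbb{N}\}\le B_i$; (A5) $D:=\max_{i=1,\dots,d}\sup\{(x_i-y_i)^2:(x_j)_j,(y_j)_j\in X\}<+\infty$; (C1) $\boldsymbol{\xi}_0,\boldsymbol{\xi}_1,\dots$ is an independent and identically distributed sample of realizations of $\boldsymbol{\xi}$; (C2) there is an oracle which, for a given $(\mathbf{x},\boldsymbol{\xi})\in\mathbb{R}^d\times\Xi$, returns a stochastic gradient $\mathsf{G}(\mathbf{x},\boldsymbol{\xi})$ with $\mathbb{E}[\mathsf{G}(\mathbf{x},\boldsymbol{\xi})]=\nabla f(\mathbf{x})$; (C3) there is a positive number $M$ such that $\mathbb{E}[\|\mathsf{G}(\mathbf{x},\boldsymbol{\xi})\|^2]\le M^2$ for all $\mathbf{x}\in X$. Suppose also that $F(\cdot,\boldsymbol{\xi})$ is convex for almost every $\boldsymbol{\xi}\in\Xi$, and let $(\mathbf{x}_n)_{n\in\mathbb{N}}$ be the sequence generated by the algorithm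 described in the context with $\alpha_n:=1/n^\eta$ and $\beta_n:=\lambda^n$ (for $n\ge1$), where $\eta\in[1/2,1]$ and $\lambda\in(0,1)$. Let $f^\star$ denote the optimal value of the problem of minimizing $f$ over $X$, and let $X^\star:=\{\mathbf{x}^\star\in X:\langle\mathbf{x}-\mathbf{x}^\star,\nabla f(\mathbf{x}^\star)\rangle\ge0\ (\mathbf{x}\in X)\}$. (i) Under $\eta\in(1/2,1]$, $$\liminf_{n\to+\infty}\mathbb{E}\left[f(\mathbf{x}_n)-f^\star\right]=0.$$ (ii) Under $\eta\in[1/2,1)$, any accumulation point of the sequence $(\tilde{\mathbf{x}}_n)$ defined by $\tilde{\mathbf{x}}_n:=\frac1n\sum_{k=1}^n\mathbf{x}_k$ almost surely belongs to $X^\star$, and the algorithm achieves the convergence rate $$\mathbb{E}\left[f(\tilde{\mathbf{x}}_n)-f^\star\right]=\mathcal{O}\left(\frac{1}{n^{1-\eta}}\right).$$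
   Context: $\mathbb{N}=\{0,1,2,\dots\}$; $\langle\cdot,\cdot\rangle$ and $\|\cdot\|$ are the Euclidean inner product and norm on $\mathbb{R}^d$. For a symmetric positive-definite matrix $H$, $\|\mathbf{x}\|_H^2:=\langle\mathbf{x},H\mathbf{x}\rangle$, and $P_{X,H}$ is the metric projection onto $X$ under the norm $\|\cdot\|_H$. $\boldsymbol{\xi}$ is a random vector whose distribution is supported on a set $\Xi\subset\mathbb{R}^{d_1}$, and $\nabla f$ is the gradient of $f$. Algorithm. Parameters: $(\alpha_n)_{n\in\mathbb{N}}\subset(0,1)$ (here $\alpha_1=1$ is allowed), $(\beta_n)_{n\in\mathbb{N}}\subset[0,1)$, $\gamma\in[0,1)$. Initialize with $\mathbf{x}_0,\mathbf{m}_{-1}\in\mathbb{R}^d$ and a symmetric positive-definite diagonal $d\times d$ matrix $\mathsf{H}_0$. For $n=0,1,2,\dots$: set $$\mathbf{m}_n:=\beta_n\mathbf{m}_{n-1}+(1-\beta_n)\mathsf{G}(\mathbf{x}_n,\boldsymbol{\xi}_n),\qquad \hat{\mathbf{m}}_n:=\frac{\mathbf{m}_n}{1-\gamma^{n+1}};$$ take a (possibly random) symmetric positive-definite diagonal matrix $\mathsf{H}_n=\mathrm{diag}(h_{n,1},\dots,h_{n,d})$, $h_{n,i}>0$; find $\mathbf{d}_n\in\mathbb{R}^d$ solving $\mathsf{H}_n\mathbf{d}=-\hat{\mathbf{m}}_n$; set $\mathbf{x}_{n+1}:=P_{X,\mathsf{H}_n}(\mathbf{x}_n+\alpha_n\mathbf{d}_n)$.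 The iterate $\mathbf{x}_n$ is a function of $(\boldsymbol{\xi}_0,\dots,\boldsymbol{\xi}_{n-1})$. *)

theory Defs
  imports "HOL-Probability.Probability" "HOL-Library.Landau_Symbols"
begin

(* The gradient; meaningful only at points of differentiability, where it is unique. *)
definition grad :: "('a::real_inner \<Rightarrow> real) \<Rightarrow> 'a \<Rightarrow> 'a" where
  "grad f x = (THE g. GDERIV f x :> g)"

definition continuously_differentiable :: "('a::real_inner \<Rightarrow> real) \<Rightarrow> bool" where
  "continuously_differentiable f \<longleftrightarrow>
     (\<forall>x. f differentiable (at x)) \<and> continuous_on UNIV (grad f)"

definition diag_matrix :: "real ^ 'n \<Rightarrow> real ^ 'n ^ 'n" where
  "diag_matrix v = (\<chi> i j. if i = j then v $ i else 0)"

definition matrix_norm_of :: "real ^ 'n ^ 'n \<Rightarrow> real ^ 'n \<Rightarrow> real" where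
  "matrix_norm_of H x = sqrt (x \<bullet> (H *v x))"

(* For X nonempty, closed and convex and H symmetric positive definite the minimizer
   exists and is unique, so the choice made by arg_min_on is immaterial. *)
definition metric_proj :: "(real ^ 'n) set \<Rightarrow> real ^ 'n ^ 'n \<Rightarrow> real ^ 'n \<Rightarrow> real ^ 'n" where
  "metric_proj X H y = arg_min_on (\<lambda>z. matrix_norm_of H (y - z)) X"

definition VI_solutions :: "('a::real_inner) set \<Rightarrow> ('a \<Rightarrow> real) \<Rightarrow> 'a set" where
  "VI_solutions X f = {z \<in> X. \<forall>x\<in>X. (x - z) \<bullet> grad f z \<ge> 0}"

definition optimal_value :: "'a set \<Rightarrow> ('a \<Rightarrow> real) \<Rightarrow> real" where
  "optimal_value X f = (INF x\<in>X. f x)"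

definition accumulation_point :: "(nat \<Rightarrow> 'a::topological_space) \<Rightarrow> 'a \<Rightarrow> bool" where
  "accumulation_point u z \<longleftrightarrow> (\<exists>r. strict_mono r \<and> (u \<circ> r) \<longlonglongrightarrow> z)"

(* The average starts at index 1, so the initial point is not included. *)
definition averaged :: "(nat \<Rightarrow> 'a::real_vector) \<Rightarrow> nat \<Rightarrow> 'a" where
  "averaged u n = (1 / real n) *\<^sub>R (\<Sum>k=1..n. u k)"

end

theory Submission
  imports Defs
begin

text \<open>
Fix a minimizer \<open>z\<close> of \<open>f\<close> over the compact set \<open>X\<close>. The variational inequality of the projection in the
metric of \<open>H\<^sub>n = diag h\<^sub>n\<close>, combined with \<open>H\<^sub>n d\<^sub>n = - m\<^sub>n / (1 - \<gamma>\<^bsup>n+1\<^esup>)\<close>, bounds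
\<open>2 \<langle>m\<^sub>n, x\<^sub>n - z\<rangle>\<close> by a decrement of the squared \<open>H\<^sub>n\<close>-distance to \<open>z\<close>, scaled by
\<open>(1 - \<gamma>\<^bsup>n+1\<^esup>) / \<alpha>\<^sub>n\<close>, plus an error of order \<open>\<alpha>\<^sub>n \<parallel>m\<^sub>n\<parallel>\<^sup>2\<close> (\<open>preconditioned_step_le\<close>,
\<open>one_step\<close>); here \<open>H\<^sub>n \<ge> H\<^sub>0\<close> bounds the inverse of \<open>H\<^sub>n\<close>. The matrix drops out of the inner product, so its dependence on the current sample
does no harm: the mean of \<open>\<langle>G(x\<^sub>n, \<xi>\<^sub>n), x\<^sub>n - z\<rangle>\<close> is computed from the independence of
\<open>x\<^sub>n\<close> and \<open>\<xi>\<^sub>n\<close>, and convexity bounds it below by the mean gap \<open>E[f(x\<^sub>n) - f(z)]\<close>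
(\<open>gap_le_mean_inner_sgrad\<close>). The old momentum enters \<open>m\<^sub>n\<close> with the factor \<open>\<beta>\<^sub>n = l\<^sup>n\<close>, hence
only through a convergent series.

The inequalities for \<open>n = 1, \<dots>, N\<close> are summed with weights \<open>w\<^sub>n\<close> such that \<open>w\<^sub>n / \<alpha>\<^sub>n\<close> is
nondecreasing. Then, coordinate by coordinate, \<open>w\<^sub>n (1 - \<gamma>\<^bsup>n+1\<^esup>) h\<^bsub>n,i\<^esub> / \<alpha>\<^sub>n\<close> is
nondecreasing as well, and summation by parts over the bounded set \<open>X\<close> leaves only the last of
these coefficients, whose mean is controlled by the bound on \<open>E[h\<^bsub>N,i\<^esub>]\<close>. The outcome,
\<open>weighted_gap_bound\<close>, is
\<open>w\<^sub>1 g\<^sub>1 + \<dots> + w\<^sub>N g\<^sub>N \<le> C (w\<^sub>N / \<alpha>\<^sub>N + \<Sum>\<^sub>n w\<^sub>n l\<^sup>n + \<Sum>\<^sub>n w\<^sub>n \<alpha>\<^sub>n)\<close>, where \<open>g\<^sub>n = E[f(x\<^sub>n) - f(z)]\<close>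
and the sums run over \<open>n = 1, \<dots>, N\<close>.
With \<open>w = \<alpha>\<close> and \<open>\<eta> > 1/2\<close> the right-hand side is bounded while \<open>\<alpha>\<close> is not summable, so the mean
gaps have lower limit \<open>0\<close>. With \<open>w = 1\<close> it is of order \<open>N\<^sup>\<eta>\<close>, and Jensen's inequality gives
the rate for the averages.

The iteration may start outside \<open>X\<close>, where the stochastic gradient is known to have a first moment
only. So \<open>m\<^sub>n\<close> is split into a rapidly vanishing multiple of \<open>m\<^sub>0\<close>, which is charged
linearly, and a remainder \<open>fresh\<close> that is bounded in mean square; the summation starts at \<open>n = 1\<close>.

For the almost sure statement, the gaps are nonnegative, so their running average at
\<open>N\<close> is at most twice their average at the next power of two. The means of the averages at powers of two are bounded by a geometric sequence and hence summable, so these averages tend to \<open>0\<close>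
almost surely, and then so do all of them (\<open>averages_tendsto_zero_AE\<close>). By convexity
\<open>f\<close> tends to its minimum along the averaged iterates, and every accumulation point is a minimizer.
\<close>

section \<open>Gradients and convexity\<close>

text \<open>
The limit is one-sided because a minimality property over \<open>X\<close> only concerns directions that point
from \<open>x\<close> into \<open>X\<close>.
\<close>
lemma GDERIV_directional_limit:
  assumes "GDERIV f x :> g"
  shows "((\<lambda>t. (f (x + t *\<^sub>R v) - f x) / t) \<longlongrightarrow> v \<bullet> g) (at_right 0)"
proof -
  have "((\<lambda>t::real. f (x + t *\<^sub>R v)) has_derivative (\<lambda>t. (t *\<^sub>R v) \<bullet> g)) (at 0)"
  proof -
    have "((\<lambda>t::real. x + t *\<^sub>R v) has_derivative (\<lambda>t. t *\<^sub>R v)) (at 0)"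
      by (auto intro!: derivative_eq_intros)
    moreover have "(f has_derivative (\<lambda>h. h \<bullet> g)) (at (x + 0 *\<^sub>R v))"
      using assms by (simp add: gderiv_def)
    ultimately show ?thesis
      using has_derivative_compose by blast
  qed
  then have "((\<lambda>t::real. f (x + t *\<^sub>R v)) has_field_derivative (v \<bullet> g)) (at 0)"
    by (simp add: has_field_derivative_def mult_commute_abs mult.commute)
  then have "((\<lambda>t. (f (x + t *\<^sub>R v) - f x) / t) \<longlongrightarrow> v \<bullet> g) (at 0)"
    by (simp add: has_field_derivative_iff)
  then show ?thesis
    by (rule tendsto_mono[rotated]) (simp add: at_le)
qed

lemma grad_eqI:
  assumes "GDERIV f x :> g"
  shows "grad f x = g"
  unfolding grad_def
proof (rule the_equality)
  fix g' assume "GDERIV f x :> g'"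
  with assms have "(\<lambda>h. h \<bullet> g') = (\<lambda>h. h \<bullet> g)"
    unfolding gderiv_def by (rule has_derivative_unique[rotated])
  then have "(g' - g) \<bullet> g' = (g' - g) \<bullet> g" by metis
  then have "(g' - g) \<bullet> (g' - g) = 0" by (simp add: inner_diff_right)
  then show "g' = g" by simp
qed fact

text \<open>
By convexity the difference quotients of \<open>f\<close> along the segment from \<open>x\<close> to \<open>y\<close> are at most
\<open>f y - f x\<close>; they tend to the directional derivative.
\<close>
lemma convex_on_above_tangent_plane:
  assumes "convex_on UNIV f" and "GDERIV f x :> g"
  shows "f x - f y \<le> (x - y) \<bullet> g"
proof -
  have "(f (x + t *\<^sub>R (y - x)) - f x) / t \<le> f y - f x" if t: "0 < t" "t < 1" for t
  proof -
    have "f (x + t *\<^sub>R (y - x)) = f ((1 - t) *\<^sub>R x + t *\<^sub>R y)"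
      by (simp add: algebra_simps)
    also have "\<dots> \<le> (1 - t) * f x + t * f y"
      using assms(1) t by (intro convex_onD) auto
    finally show ?thesis
      using t by (simp add: field_simps)
  qed
  then have "\<forall>\<^sub>F t in at_right 0. (f (x + t *\<^sub>R (y - x)) - f x) / t \<le> f y - f x"
    unfolding eventually_at_right_field by (intro exI[of _ 1]) auto
  from tendsto_upperbound[OF GDERIV_directional_limit[OF assms(2)] this]
  have "(y - x) \<bullet> g \<le> f y - f x" by simp
  then show ?thesis by (simp add: inner_diff_left)
qed

text \<open>
First-order optimality: the segment from \<open>z\<close> to any \<open>y\<close> stays in \<open>X\<close>, so the difference quotients at
\<open>z\<close> are nonnegative.
\<close>
lemma minimizer_in_VI_solutions:
  assumes "convex X" and z: "z \<in> X" and min: "\<And>y. y \<in> X \<Longrightarrow> f z \<le> f y"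
    and "GDERIV f z :> g"
  shows "z \<in> VI_solutions X f"
proof -
  have "0 \<le> (y - z) \<bullet> g" if y: "y \<in> X" for y
  proof -
    have "0 \<le> (f (z + t *\<^sub>R (y - z)) - f z) / t" if t: "0 < t" "t < 1" for t
    proof -
      have "z + t *\<^sub>R (y - z) = (1 - t) *\<^sub>R z + t *\<^sub>R y" by (simp add: algebra_simps)
      then have "z + t *\<^sub>R (y - z) \<in> X"
        using convexD_alt[OF assms(1) z y, of t] t by simp
      with min t show ?thesis by simp
    qed
    then have "\<forall>\<^sub>F t in at_right 0. 0 \<le> (f (z + t *\<^sub>R (y - z)) - f z) / t"
      unfolding eventually_at_right_field by (intro exI[of _ 1]) auto
    from tendsto_lowerbound[OF GDERIV_directional_limit[OF assms(4)] this]
    show ?thesis by simp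
  qed
  then show ?thesis
    using z grad_eqI[OF assms(4)] by (simp add: VI_solutions_def)
qed

lemma optimal_value_eq:
  assumes "z \<in> X" "\<And>y. y \<in> X \<Longrightarrow> f z \<le> f y"
  shows "optimal_value X f = f z"
  unfolding optimal_value_def by (rule cInf_eq_minimum) (use assms in auto)

lemma averaged_in_convex:
  assumes "convex X" "n \<ge> 1" "\<And>k. k \<ge> 1 \<Longrightarrow> u k \<in> X"
  shows "averaged u n \<in> X"
proof -
  have "(\<Sum>k=1..n. (1 / real n) *\<^sub>R u k) \<in> X"
    using assms by (intro convex_sum) auto
  then show ?thesis by (simp add: averaged_def scaleR_sum_right)
qed

lemma convex_on_averaged_le:
  assumes "convex_on UNIV f" "n \<ge> 1"
  shows "f (averaged u n) \<le> (\<Sum>k=1..n. f (u k)) / real n"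
proof -
  have "f (\<Sum>k=1..n. (1 / real n) *\<^sub>R u k) \<le> (\<Sum>k=1..n. (1 / real n) * f (u k))"
    using assms by (intro convex_on_sum[where C = UNIV]) auto
  then show ?thesis by (simp add: averaged_def scaleR_sum_right sum_divide_distrib)
qed

section \<open>Elementary sums and inequalities\<close>

text \<open>
Summation by parts. The sum equals \<open>b\<^sub>1 u\<^sub>1 + (b\<^sub>2 - b\<^sub>1) u\<^sub>2 + \<dots> + (b\<^sub>N - b\<^bsub>N-1\<^esub>) u\<^sub>N - b\<^sub>N u\<^bsub>N+1\<^esub>\<close>,
and replacing \<open>u\<^sub>1, \<dots>, u\<^sub>N\<close> by \<open>D\<close> makes the first terms telescope to \<open>D b\<^sub>N\<close>.
\<close>
lemma sum_weighted_decrements_le: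
  fixes b u :: "nat \<Rightarrow> real"
  assumes "N \<ge> 1" and b0: "b 1 \<ge> 0"
    and mono: "\<And>n. n \<ge> 1 \<Longrightarrow> b n \<le> b (Suc n)"
    and u: "\<And>n. n \<ge> 1 \<Longrightarrow> 0 \<le> u n" "\<And>n. n \<ge> 1 \<Longrightarrow> u n \<le> D"
  shows "(\<Sum>n=1..N. b n * (u n - u (Suc n))) \<le> D * b N"
proof -
  have bN: "b N \<ge> 0"
    using \<open>N \<ge> 1\<close> by (induction N rule: dec_induct) (use b0 mono in \<open>auto intro: order_trans\<close>)
  have "(\<Sum>n=1..N. b n * (u n - u (Suc n))) \<le> b N * (D - u (Suc N))"
    using \<open>N \<ge> 1\<close>
  proof (induction N rule: dec_induct)
    case base
    then show ?case using b0 u(2)[of 1] by (simp add: mult_left_mono)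
  next
    case (step N)
    have "(b (Suc N) - b N) * u (Suc N) \<le> (b (Suc N) - b N) * D"
      using mono[of N] step(1) u(2)[of "Suc N"] by (intro mult_left_mono) auto
    with step.IH show ?case by (simp add: algebra_simps)
  qed
  also have "\<dots> \<le> b N * D"
    using bN u(1)[of "Suc N"] by (intro mult_left_mono) auto
  finally show ?thesis by (simp add: mult.commute)
qed

text \<open>
For \<open>\<eta> \<ge> 1/2\<close> the \<open>n\<close>-th term is at most \<open>1 / \<surd>n \<le> 2 (\<surd>n - \<surd>(n - 1))\<close>, which telescopes. The true
order \<open>N\<^bsup>1-\<eta>\<^esup>\<close> is at most \<open>N\<^sup>\<eta>\<close>, and \<open>N\<^sup>\<eta>\<close> is the order of the other terms that this sum is
added to.
\<close>
lemma sum_powr_minus_le: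
  assumes "1/2 \<le> \<eta>"
  shows "(\<Sum>n=1..N. 1 / real n powr \<eta>) \<le> 2 * real N powr \<eta>"
proof -
  have step: "1 / real n powr \<eta> \<le> 2 * (sqrt (real n) - sqrt (real (n - 1)))" if "n \<ge> 1" for n
  proof -
    define a b where "a = sqrt (real n)" and "b = sqrt (real (n - 1))"
    have a: "a > 0" "a * a - b * b = 1" using that by (auto simp: a_def b_def of_nat_diff)
    have "a \<le> real n powr \<eta>"
      unfolding a_def using powr_mono[OF assms, of "real n"] that by (simp add: powr_half_sqrt)
    then have "1 / real n powr \<eta> \<le> 1 / a"
      using a that by (intro divide_left_mono mult_pos_pos) auto
    \<comment> \<open>\<open>2 (a - b) a = (a\<^sup>2 - b\<^sup>2) + (a - b)\<^sup>2\<close>, and the first summand is \<open>1\<close>\<close>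
    also have "1 \<le> 2 * (a - b) * a"
    proof -
      have "0 \<le> (a - b) * (a - b)" by simp
      then show ?thesis using a(2) by (simp only: algebra_simps)
    qed
    then have "1 / a \<le> 2 * (a - b)"
      using a(1) by (simp only: pos_divide_le_eq)
    finally show ?thesis unfolding a_def b_def .
  qed
  have "(\<Sum>n=1..N. 1 / real n powr \<eta>) \<le> 2 * sqrt (real N)"
  proof (induction N)
    case (Suc N)
    then show ?case using step[of "Suc N"] by (simp add: algebra_simps)
  qed simp
  also have "sqrt (real N) \<le> real N powr \<eta>"
    using powr_mono[OF assms, of "real N"] by (cases "N = 0") (auto simp: powr_half_sqrt)
  finally show ?thesis by simp
qed

lemma sum_geometric_le:
  assumes "0 \<le> l" "l < (1 :: real)"
  shows "(\<Sum>n=1..N. l ^ n) \<le> 1 / (1 - l)"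
proof -
  have "(\<Sum>n=1..N. l ^ n) \<le> (\<Sum>n. l ^ n)"
    using assms by (intro sum_le_suminf summable_geometric) auto
  then show ?thesis using assms by (simp add: suminf_geometric)
qed

text \<open>The difference of the two sides is \<open>t (1 - t) \<parallel>u - v\<parallel>\<^sup>2\<close>.\<close>
lemma norm_convex_combination_sq_le:
  fixes u v :: "'a :: real_inner"
  assumes "0 \<le> t" "t \<le> 1"
  shows "(norm (t *\<^sub>R u + (1 - t) *\<^sub>R v))\<^sup>2 \<le> t * (norm u)\<^sup>2 + (1 - t) * (norm v)\<^sup>2"
proof -
  have "t * (norm u)\<^sup>2 + (1 - t) * (norm v)\<^sup>2 - (norm (t *\<^sub>R u + (1 - t) *\<^sub>R v))\<^sup>2
      = t * (1 - t) * (norm (u - v))\<^sup>2"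
    unfolding power2_norm_eq_inner by (simp add: algebra_simps inner_commute)
  moreover have "0 \<le> t * (1 - t) * (norm (u - v))\<^sup>2" using assms by simp
  ultimately show ?thesis by linarith
qed

lemma le_one_plus_square: "(a :: real) \<le> 1 + a\<^sup>2"
proof -
  have "0 \<le> (a - 1/2)\<^sup>2" by simp
  then show ?thesis by (simp add: power2_eq_square algebra_simps)
qed

section \<open>Projections in a diagonal metric\<close>

lemma inner_diag_matrix:
  fixes u v w :: "real ^ 'n"
  shows "u \<bullet> (diag_matrix w *v v) = (\<Sum>i\<in>UNIV. w $ i * (u $ i * v $ i))"
proof -
  have "(diag_matrix w *v v) $ i = w $ i * v $ i" for i
    by (simp add: diag_matrix_def matrix_vector_mult_def if_distrib if_distribR cong: if_cong)
  then show ?thesis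
    by (simp add: inner_vec_def mult_ac)
qed

text \<open>
The variational inequality is the first-order optimality condition of the projection: the squared
distance of \<open>y\<close> to \<open>p + t (z - p) \<in> X\<close> is a quadratic polynomial in \<open>t\<close> that is minimal at \<open>t = 0\<close>.
\<close>
lemma metric_proj_diag:
  fixes X :: "(real ^ 'n) set" and y :: "real ^ 'n"
  assumes X: "compact X" "convex X" "X \<noteq> {}" and w: "\<And>i. w $ i > 0"
  defines "p \<equiv> metric_proj X (diag_matrix w) y"
  shows metric_proj_diag_in: "p \<in> X"
    and metric_proj_diag_variational: "z \<in> X \<Longrightarrow> (z - p) \<bullet> (diag_matrix w *v (y - p)) \<le> 0"
proof -
  define q where "q \<equiv> \<lambda>v :: real ^ 'n. v \<bullet> (diag_matrix w *v v)"
  have cont: "continuous_on X (\<lambda>z. matrix_norm_of (diag_matrix w) (y - z))"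
    unfolding matrix_norm_of_def inner_diag_matrix by (intro continuous_intros)
  then obtain z0 where "z0 \<in> X"
      "\<forall>z\<in>X. matrix_norm_of (diag_matrix w) (y - z0) \<le> matrix_norm_of (diag_matrix w) (y - z)"
    using continuous_attains_inf[OF X(1,3) cont] by blast
  then have "is_arg_min (\<lambda>z. matrix_norm_of (diag_matrix w) (y - z)) (\<lambda>z. z \<in> X) z0"
    by (auto simp: is_arg_min_def not_less)
  then have "is_arg_min (\<lambda>z. matrix_norm_of (diag_matrix w) (y - z)) (\<lambda>z. z \<in> X) p"
    unfolding p_def metric_proj_def arg_min_on_def arg_min_def by (rule someI)
  then have p: "p \<in> X" and "\<And>z. z \<in> X \<Longrightarrow> q (y - p) \<le> q (y - z)"
    by (auto simp: is_arg_min_def not_less matrix_norm_of_def q_def)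
  note min = this(2)
  show "p \<in> X" by fact
  assume z: "z \<in> X"
  define B where "B = (z - p) \<bullet> (diag_matrix w *v (y - p))"
  have exp: "q (y - (p + t *\<^sub>R (z - p))) = q (y - p) - 2 * t * B + t\<^sup>2 * q (z - p)" for t
    unfolding q_def B_def inner_diag_matrix
    by (simp add: sum_distrib_left sum_distrib_right sum.distrib [symmetric] sum_subtractf [symmetric]
        algebra_simps power2_eq_square cong: sum.cong)
  have le: "2 * B \<le> t * q (z - p)" if t: "0 < t" "t \<le> 1" for t
  proof -
    have "p + t *\<^sub>R (z - p) = (1 - t) *\<^sub>R p + t *\<^sub>R z"
      by (simp add: algebra_simps)
    then have "p + t *\<^sub>R (z - p) \<in> X"
      using convexD_alt[OF X(2) p z, of t] t by simp
    from min[OF this] have "t * (2 * B) \<le> t * (t * q (z - p))"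
      unfolding exp by (simp add: power2_eq_square algebra_simps)
    then show ?thesis using t by simp
  qed
  have lim: "((\<lambda>t. t * q (z - p)) \<longlongrightarrow> 0 * q (z - p)) (at_right 0)"
    by (intro tendsto_intros)
  have "\<forall>\<^sub>F t in at_right 0. 2 * B \<le> t * q (z - p)"
    unfolding eventually_at_right_field by (intro exI[of _ 1]) (auto intro: le)
  from tendsto_lowerbound[OF lim this] have "2 * B \<le> 0" by simp
  then show "B \<le> 0" by simp
qed

text \<open>
The variational inequality at \<open>z\<close>, rewritten with the three-point identity for the squared
\<open>w\<close>-distances, bounds \<open>2 \<tau> \<langle>p + r, y' - z\<rangle>\<close> by the decrement of the distance to \<open>z\<close> minus the squared
length of the step \<open>y - y'\<close>. Passing from \<open>y'\<close> to \<open>y\<close> costs \<open>2 \<tau> \<langle>p + r, y - y'\<rangle>\<close>. The part with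
\<open>p\<close> is absorbed by the squared step length at the price of a term quadratic in \<open>p\<close>; the part with
\<open>r\<close> is only charged linearly, since both points lie in the bounded set \<open>X\<close>. The lemma is applied with
an \<open>r\<close> that need not have a second moment.
\<close>
lemma preconditioned_step_le:
  fixes y y' z :: "real ^ 'n"
  assumes X: "compact X" "convex X" "X \<noteq> {}" and w: "\<And>i. w $ i \<ge> \<mu>" "\<mu> > 0"
    and "\<tau> > 0" and y: "y \<in> X" and z: "z \<in> X"
    and d: "diag_matrix w *v d = - (p + r)"
    and y': "y' = metric_proj X (diag_matrix w) (y + \<tau> *\<^sub>R d)"
  shows "2 * ((p + r) \<bullet> (y - z))
      \<le> (\<Sum>i\<in>UNIV. w $ i * (((y - z) $ i)\<^sup>2 - ((y' - z) $ i)\<^sup>2)) / \<tau>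
        + 2 * diameter X * norm r + \<tau> / \<mu> * (norm p)\<^sup>2"
proof -
  have wp: "w $ i > 0" for i using w(1)[of i] w(2) by simp
  have y'X: "y' \<in> X" unfolding y' by (rule metric_proj_diag_in[OF X wp])
  have "0 \<ge> (z - y') \<bullet> (diag_matrix w *v (y + \<tau> *\<^sub>R d - y'))"
    unfolding y' by (rule metric_proj_diag_variational[OF X wp z])
  also have "(z - y') \<bullet> (diag_matrix w *v (y + \<tau> *\<^sub>R d - y'))
     = (z - y') \<bullet> (diag_matrix w *v (y - y')) + \<tau> * ((z - y') \<bullet> (diag_matrix w *v d))"
    by (simp add: matrix_vector_right_distrib matrix_vector_mult_diff_distrib inner_add_right
        inner_diff_right matrix_vector_mult_scaleR algebra_simps)
  finally have vi: "(z - y') \<bullet> (diag_matrix w *v (y - y')) \<le> \<tau> * ((z - y') \<bullet> (p + r))"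
    unfolding d by (simp add: algebra_simps)
  have exp: "2 * ((z - y') \<bullet> (diag_matrix w *v (y - y'))) =
      (\<Sum>i\<in>UNIV. w $ i * ((y' - z) $ i)\<^sup>2) - (\<Sum>i\<in>UNIV. w $ i * ((y - z) $ i)\<^sup>2)
      + (\<Sum>i\<in>UNIV. w $ i * ((y - y') $ i)\<^sup>2)"
    unfolding inner_diag_matrix
    by (simp add: sum_distrib_left sum.distrib [symmetric] sum_subtractf [symmetric]
        algebra_simps power2_eq_square cong: sum.cong)
  have "2 * \<tau> * (p \<bullet> (y - y')) \<le> (\<Sum>i\<in>UNIV. w $ i * ((y - y') $ i)\<^sup>2) + \<tau>\<^sup>2 / \<mu> * (norm p)\<^sup>2"
  proof -
    have i: "2 * \<tau> * (p $ i * (y - y') $ i) \<le> w $ i * ((y - y') $ i)\<^sup>2 + \<tau>\<^sup>2 / \<mu> * (p $ i)\<^sup>2" for i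
    proof -
      define s where "s = (y - y') $ i"
      have "0 \<le> (\<tau> * p $ i - \<mu> * s)\<^sup>2 / \<mu>" using w by simp
      also have "\<dots> = \<tau>\<^sup>2 / \<mu> * (p $ i)\<^sup>2 - 2 * \<tau> * (p $ i * s) + \<mu> * s\<^sup>2"
        using w(2) by (simp add: field_simps power2_eq_square)
      also have "\<mu> * s\<^sup>2 \<le> w $ i * s\<^sup>2" using w by (intro mult_right_mono) auto
      finally show ?thesis by (simp add: s_def)
    qed
    have "(norm p)\<^sup>2 = (\<Sum>i\<in>UNIV. (p $ i)\<^sup>2)"
      unfolding power2_norm_eq_inner inner_vec_def by (simp add: power2_eq_square)
    then show ?thesis
      using sum_mono[of UNIV, OF i] by (simp add: inner_vec_def sum_distrib_left sum.distrib)
  qed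
  moreover have "r \<bullet> (y - y') \<le> diameter X * norm r"
  proof -
    have "norm (y - y') \<le> diameter X"
      using diameter_bounded_bound[OF compact_imp_bounded[OF X(1)] y y'X] by (simp add: dist_norm)
    from mult_right_mono[OF this norm_ge_zero[of r]] show ?thesis
      using norm_cauchy_schwarz[of r "y - y'"] by (simp add: mult.commute)
  qed
  then have "2 * \<tau> * (r \<bullet> (y - y')) \<le> 2 * \<tau> * (diameter X * norm r)"
    using \<open>\<tau> > 0\<close> by simp
  moreover have "\<tau> * (2 * ((p + r) \<bullet> (y - z))) =
      2 * \<tau> * (p \<bullet> (y - y')) + 2 * \<tau> * (r \<bullet> (y - y')) - 2 * (\<tau> * ((z - y') \<bullet> (p + r)))"
    by (simp add: algebra_simps inner_commute)
  moreover have "(\<Sum>i\<in>UNIV. w $ i * (((y - z) $ i)\<^sup>2 - ((y' - z) $ i)\<^sup>2))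
      = (\<Sum>i\<in>UNIV. w $ i * ((y - z) $ i)\<^sup>2) - (\<Sum>i\<in>UNIV. w $ i * ((y' - z) $ i)\<^sup>2)"
    by (simp add: right_diff_distrib sum_subtractf)
  ultimately have "\<tau> * (2 * ((p + r) \<bullet> (y - z))) \<le>
      (\<Sum>i\<in>UNIV. w $ i * (((y - z) $ i)\<^sup>2 - ((y' - z) $ i)\<^sup>2))
      + 2 * \<tau> * (diameter X * norm r) + \<tau>\<^sup>2 / \<mu> * (norm p)\<^sup>2"
    using vi exp by linarith
  then have "2 * ((p + r) \<bullet> (y - z)) \<le> ((\<Sum>i\<in>UNIV. w $ i * (((y - z) $ i)\<^sup>2 - ((y' - z) $ i)\<^sup>2))
      + 2 * \<tau> * (diameter X * norm r) + \<tau>\<^sup>2 / \<mu> * (norm p)\<^sup>2) / \<tau>"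
    using \<open>\<tau> > 0\<close> by (simp add: pos_le_divide_eq mult.commute)
  then show ?thesis
    using \<open>\<tau> > 0\<close> by (simp add: add_divide_distrib power2_eq_square)
qed

section \<open>Independence and averages of random variables\<close>

lemma (in prob_space) integrable_of_norm_sq:
  fixes u :: "'a \<Rightarrow> 'b :: {banach, second_countable_topology}"
  assumes "u \<in> borel_measurable M" "integrable M (\<lambda>\<omega>. (norm (u \<omega>))\<^sup>2)"
  shows "integrable M u"
  by (rule Bochner_Integration.integrable_bound[of M "\<lambda>\<omega>. 1 + (norm (u \<omega>))\<^sup>2"])
    (use assms le_one_plus_square in \<open>auto\<close>)

context prob_space
begin

text \<open>
Freezing an independent variable: if the joint law of \<open>U\<close> and \<open>V\<close> is a product, the mean of
\<open>g (U, V)\<close> may be taken over \<open>V\<close> first, with the value of \<open>U\<close> held fixed. Independence is expressed by the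
factorization of the joint law, so that \<open>U\<close> and \<open>V\<close> may take values in different types.
\<close>
lemma nn_integral_product_distr:
  assumes [measurable]: "U \<in> measurable M S" "V \<in> measurable M T"
    and eq: "distr M (S \<Otimes>\<^sub>M T) (\<lambda>\<omega>. (U \<omega>, V \<omega>)) = distr M S U \<Otimes>\<^sub>M distr M T V"
    and g[measurable]: "g \<in> borel_measurable (S \<Otimes>\<^sub>M T)"
  shows "(\<integral>\<^sup>+\<omega>. g (U \<omega>, V \<omega>) \<partial>M) = (\<integral>\<^sup>+\<omega>. (\<integral>\<^sup>+\<omega>'. g (U \<omega>, V \<omega>') \<partial>M) \<partial>M)"
proof -
  interpret V: prob_space "distr M T V" by (rule prob_space_distr) measurable
  have "(\<integral>\<^sup>+\<omega>. g (U \<omega>, V \<omega>) \<partial>M) = (\<integral>\<^sup>+p. g p \<partial>(distr M S U \<Otimes>\<^sub>M distr M T V))"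
    unfolding eq[symmetric] by (subst nn_integral_distr) auto
  also have "\<dots> = (\<integral>\<^sup>+u. (\<integral>\<^sup>+v. g (u, v) \<partial>distr M T V) \<partial>distr M S U)"
    by (subst V.nn_integral_fst) auto
  also have "\<dots> = (\<integral>\<^sup>+\<omega>. (\<integral>\<^sup>+v. g (U \<omega>, v) \<partial>distr M T V) \<partial>M)"
    by (subst nn_integral_distr) auto
  also have "\<dots> = (\<integral>\<^sup>+\<omega>. (\<integral>\<^sup>+\<omega>'. g (U \<omega>, V \<omega>') \<partial>M) \<partial>M)"
    by (intro nn_integral_cong, subst nn_integral_distr) (auto dest: measurable_space[OF \<open>U \<in> measurable M S\<close>])
  finally show ?thesis .
qed

lemma
  fixes g :: "'b \<times> 'c \<Rightarrow> real"
  assumes [measurable]: "U \<in> measurable M S" "V \<in> measurable M T"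
    and eq: "distr M (S \<Otimes>\<^sub>M T) (\<lambda>\<omega>. (U \<omega>, V \<omega>)) = distr M S U \<Otimes>\<^sub>M distr M T V"
    and g[measurable]: "g \<in> borel_measurable (S \<Otimes>\<^sub>M T)"
    and int: "integrable M (\<lambda>\<omega>. g (U \<omega>, V \<omega>))"
  shows integrable_integral_product_distr: "integrable M (\<lambda>\<omega>. \<integral>\<omega>'. g (U \<omega>, V \<omega>') \<partial>M)"
    and integral_product_distr:
      "(\<integral>\<omega>. g (U \<omega>, V \<omega>) \<partial>M) = (\<integral>\<omega>. (\<integral>\<omega>'. g (U \<omega>, V \<omega>') \<partial>M) \<partial>M)"
proof -
  interpret V: prob_space "distr M T V" by (rule prob_space_distr) measurable
  interpret U: prob_space "distr M S U" by (rule prob_space_distr) measurable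
  interpret UV: pair_sigma_finite "distr M S U" "distr M T V" ..
  have gint: "integrable (distr M S U \<Otimes>\<^sub>M distr M T V) g"
    unfolding eq[symmetric] using int by (subst integrable_distr_eq) auto
  have inner: "(\<integral>v. g (U \<omega>, v) \<partial>distr M T V) = (\<integral>\<omega>'. g (U \<omega>, V \<omega>') \<partial>M)" if "\<omega> \<in> space M" for \<omega>
    using measurable_space[OF \<open>U \<in> measurable M S\<close> that]
    by (subst integral_distr) auto
  have "integrable M (\<lambda>\<omega>. \<integral>v. g (U \<omega>, v) \<partial>distr M T V)"
    using UV.integrable_fst'[OF gint] by (subst (asm) integrable_distr_eq) auto
  then show "integrable M (\<lambda>\<omega>. \<integral>\<omega>'. g (U \<omega>, V \<omega>') \<partial>M)"
    by (subst (asm) Bochner_Integration.integrable_cong[OF refl inner])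
  have "(\<integral>\<omega>. g (U \<omega>, V \<omega>) \<partial>M) = (\<integral>p. g p \<partial>(distr M S U \<Otimes>\<^sub>M distr M T V))"
    unfolding eq[symmetric] by (subst integral_distr) auto
  also have "\<dots> = (\<integral>u. (\<integral>v. g (u, v) \<partial>distr M T V) \<partial>distr M S U)"
    using UV.integral_fst'[OF gint] by simp
  also have "\<dots> = (\<integral>\<omega>. (\<integral>v. g (U \<omega>, v) \<partial>distr M T V) \<partial>M)"
    by (subst integral_distr) auto
  also have "\<dots> = (\<integral>\<omega>. (\<integral>\<omega>'. g (U \<omega>, V \<omega>') \<partial>M) \<partial>M)"
    by (intro Bochner_Integration.integral_cong inner) auto
  finally show "(\<integral>\<omega>. g (U \<omega>, V \<omega>) \<partial>M) = (\<integral>\<omega>. (\<integral>\<omega>'. g (U \<omega>, V \<omega>') \<partial>M) \<partial>M)" .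
qed

text \<open>
The vector of the first \<open>n\<close> variables and the \<open>n\<close>-th one are independent, and the factorization of a
joint law is preserved by applying a measurable map to each component.
\<close>
lemma
  fixes Y :: "nat \<Rightarrow> 'a \<Rightarrow> 'b"
  assumes indep: "indep_vars (\<lambda>_. N) Y UNIV" and \<phi>[measurable]: "\<phi> \<in> measurable (Pi\<^sub>M {..<n} (\<lambda>_. N)) S"
    and U: "\<And>\<omega>. \<omega> \<in> space M \<Longrightarrow> U \<omega> = \<phi> (\<lambda>k\<in>{..<n}. Y k \<omega>)"
  shows measurable_of_past: "U \<in> measurable M S"
    and distr_past_present:
      "distr M (S \<Otimes>\<^sub>M N) (\<lambda>\<omega>. (U \<omega>, Y n \<omega>)) = distr M S U \<Otimes>\<^sub>M distr M N (Y n)"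
proof -
  have Y[measurable]: "Y k \<in> measurable M N" for k
    using indep by (auto simp: indep_vars_def)
  let ?P = "Pi\<^sub>M {..<n} (\<lambda>_. N)" and ?Q = "Pi\<^sub>M {n} (\<lambda>_. N)"
  define p where "p \<equiv> \<lambda>\<omega>. \<lambda>k\<in>{..<n}. Y k \<omega>"
  define q where "q \<equiv> \<lambda>\<omega>. \<lambda>k\<in>{n}. Y k \<omega>"
  have [measurable]: "p \<in> measurable M ?P" "q \<in> measurable M ?Q"
    unfolding p_def q_def by measurable
  have pq: "distr M ?P p \<Otimes>\<^sub>M distr M ?Q q = distr M (?P \<Otimes>\<^sub>M ?Q) (\<lambda>\<omega>. (p \<omega>, q \<omega>))"
  proof -
    have "indep_var ?P p ?Q q"
      unfolding p_def q_def by (intro indep_var_restrict[OF indep]) auto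
    then show ?thesis by (simp add: indep_var_distribution_eq)
  qed
  have \<phi>p[measurable]: "(\<lambda>\<omega>. \<phi> (p \<omega>)) \<in> measurable M S" by measurable
  then show "U \<in> measurable M S"
    using U by (subst measurable_cong[where g = "\<lambda>\<omega>. \<phi> (p \<omega>)"]) (auto simp: p_def)
  have n[measurable]: "(\<lambda>g. g n) \<in> measurable ?Q N" by measurable
  have "distr M S U = distr M S (\<lambda>\<omega>. \<phi> (p \<omega>))"
    by (intro distr_cong) (auto simp: U p_def)
  also have "\<dots> = distr (distr M ?P p) S \<phi>"
    by (simp add: distr_distr o_def)
  finally have U': "distr M S U = distr (distr M ?P p) S \<phi>" .
  have Y': "distr M N (Y n) = distr (distr M ?Q q) N (\<lambda>g. g n)"
    by (simp add: distr_distr o_def q_def)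
  have "sigma_finite_measure (distr (distr M ?Q q) N (\<lambda>g. g n))"
    unfolding Y'[symmetric] by (intro prob_space_imp_sigma_finite prob_space_distr Y)
  then have "distr M S U \<Otimes>\<^sub>M distr M N (Y n)
      = distr (distr M ?P p \<Otimes>\<^sub>M distr M ?Q q) (S \<Otimes>\<^sub>M N) (\<lambda>(a, b). (\<phi> a, b n))"
    unfolding U' Y' by (intro pair_measure_distr) auto
  also have "\<dots> = distr M (S \<Otimes>\<^sub>M N) (\<lambda>\<omega>. (\<phi> (p \<omega>), Y n \<omega>))"
    unfolding pq by (subst distr_distr) (auto simp: o_def q_def)
  also have "\<dots> = distr M (S \<Otimes>\<^sub>M N) (\<lambda>\<omega>. (U \<omega>, Y n \<omega>))"
    by (intro distr_cong) (auto simp: U p_def)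
  finally show "distr M (S \<Otimes>\<^sub>M N) (\<lambda>\<omega>. (U \<omega>, Y n \<omega>)) = distr M S U \<Otimes>\<^sub>M distr M N (Y n)" ..
qed

end

text \<open>
The averages at \<open>N = 2\<^sup>j\<close> have means at most \<open>C 2\<^bsup>-pj\<^esup>\<close>. These are summable, so by monotone
convergence the averages themselves are summable over \<open>j\<close> almost surely and tend to \<open>0\<close>. Since the
summands are nonnegative, the average at any \<open>N\<close> between \<open>2\<^sup>j\<close> and \<open>2\<^bsup>j+1\<^esup>\<close> is at most twice the one at
\<open>2\<^bsup>j+1\<^esup>\<close>.
\<close>
lemma averages_tendsto_zero_AE:
  fixes g :: "nat \<Rightarrow> 'w \<Rightarrow> real"
  assumes int: "\<And>k. k \<ge> 1 \<Longrightarrow> integrable M (g k)"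
    and nonneg: "\<And>k \<omega>. k \<ge> 1 \<Longrightarrow> \<omega> \<in> space M \<Longrightarrow> 0 \<le> g k \<omega>"
    and "p > 0"
    and bound: "\<And>N. N \<ge> 1 \<Longrightarrow> (\<Sum>k=1..N. \<integral>\<omega>. g k \<omega> \<partial>M) \<le> C * real N powr (1 - p)"
  shows "AE \<omega> in M. (\<lambda>N. (\<Sum>k=1..N. g k \<omega>) / real N) \<longlonglongrightarrow> 0"
proof -
  define S where "S \<equiv> \<lambda>N \<omega>. \<Sum>k=1..N. g k \<omega>"
  define T where "T \<equiv> \<lambda>j \<omega>. S (2 ^ j) \<omega> / 2 ^ j"
  have S_int: "integrable M (S N)" for N
    unfolding S_def using int by (intro Bochner_Integration.integrable_sum) auto
  then have T_int: "integrable M (T j)" for j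
    unfolding T_def by (intro integrable_divide) auto
  have S_nonneg: "0 \<le> S N \<omega>" if "\<omega> \<in> space M" for N \<omega>
    unfolding S_def using nonneg that by (intro sum_nonneg) auto
  then have T_nonneg: "0 \<le> T j \<omega>" if "\<omega> \<in> space M" for j \<omega>
    unfolding T_def using that by simp
  have T_le: "(\<integral>\<omega>. T j \<omega> \<partial>M) \<le> C * (2 powr (- p)) ^ j" for j
  proof -
    have "(\<integral>\<omega>. S (2 ^ j) \<omega> \<partial>M) \<le> C * real (2 ^ j) powr (1 - p)"
      unfolding S_def using int bound[of "2 ^ j"] by (subst Bochner_Integration.integral_sum) auto
    moreover have "real (2 ^ j) powr (1 - p) = 2 ^ j * (2 powr (- p)) ^ j"
    proof -
      have "(2 powr (- p)) ^ j = 2 powr (- p * real j)"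
        by (subst powr_realpow [symmetric]) (simp_all only: powr_powr powr_gt_zero)
      moreover have "real (2 ^ j) powr (1 - p) = 2 powr (real j + - p * real j)"
        by (simp add: powr_realpow [symmetric] powr_powr algebra_simps)
      ultimately show ?thesis
        by (simp only: powr_add powr_realpow)
    qed
    ultimately show ?thesis
      unfolding T_def by (simp add: field_simps)
  qed
  have C: "C * (2 powr (- p)) ^ j \<ge> 0" for j
    using T_le[of j] integral_nonneg_AE[of "T j" M] T_nonneg by (meson AE_I2 order_trans)
  have "2 powr (- p) < (1 :: real)"
    using \<open>p > 0\<close> by (simp add: powr_less_one)
  then have geo: "summable (\<lambda>j. C * (2 powr (- p)) ^ j)"
    by (intro summable_mult summable_geometric) simp
  have "(\<integral>\<^sup>+\<omega>. (\<Sum>j. ennreal (T j \<omega>)) \<partial>M) = (\<Sum>j. \<integral>\<^sup>+\<omega>. ennreal (T j \<omega>) \<partial>M)"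
    using T_int by (intro nn_integral_suminf) (auto dest: borel_measurable_integrable)
  also have "\<dots> = (\<Sum>j. ennreal (\<integral>\<omega>. T j \<omega> \<partial>M))"
    using T_int T_nonneg by (simp add: nn_integral_eq_integral)
  also have "\<dots> \<le> (\<Sum>j. ennreal (C * (2 powr (- p)) ^ j))"
    using T_le by (intro suminf_le) (auto intro: ennreal_leI)
  also have "\<dots> < \<infinity>"
    using suminf_ennreal2[OF C geo] by simp
  finally have "AE \<omega> in M. (\<Sum>j. ennreal (T j \<omega>)) \<noteq> \<infinity>"
    using T_int by (intro nn_integral_PInf_AE) (auto dest: borel_measurable_integrable)
  then show ?thesis
  proof (rule AE_mp, intro AE_I2 impI)
    fix \<omega> assume \<omega>: "\<omega> \<in> space M" and fin: "(\<Sum>j. ennreal (T j \<omega>)) \<noteq> \<infinity>"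
    have "summable (\<lambda>j. T j \<omega>)"
      using T_nonneg[OF \<omega>] fin by (intro summable_suminf_not_top) auto
    then have T0: "(\<lambda>j. T j \<omega>) \<longlonglongrightarrow> 0" by (rule summable_LIMSEQ_zero)
    show "(\<lambda>N. (\<Sum>k=1..N. g k \<omega>) / real N) \<longlonglongrightarrow> 0"
    proof (rule LIMSEQ_I)
      fix e :: real assume "e > 0"
      then obtain J where J: "\<And>j. j \<ge> J \<Longrightarrow> T j \<omega> < e / 2"
        using LIMSEQ_D[OF T0, of "e / 2"] T_nonneg[OF \<omega>] by (auto simp: abs_less_iff)
      have "norm (S N \<omega> / real N - 0) < e" if N: "N \<ge> 2 ^ J" for N
      proof -
        have N1: "N \<ge> 1" using N by (meson one_le_numeral one_le_power order_trans)
        then obtain j where j: "2 ^ j \<le> N" "N < 2 ^ (j + 1)"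
          using ex_power_ivl1[of 2 N] by auto
        have "(2::nat) ^ J < 2 ^ (j + 1)" using N j(2) by (rule le_less_trans)
        then have "J \<le> j + 1" by (intro less_imp_le, elim power_less_imp_less_exp[rotated]) simp
        then have Tj: "T (j + 1) \<omega> < e / 2" by (rule J)
        have "S N \<omega> \<le> S (2 ^ (j + 1)) \<omega>"
          unfolding S_def using j(2) nonneg \<omega> by (intro sum_mono2) auto
        then have "S N \<omega> / real N \<le> S (2 ^ (j + 1)) \<omega> / 2 ^ j"
          using j(1) S_nonneg[OF \<omega>] by (intro frac_le) (auto simp flip: of_nat_le_iff)
        also have "\<dots> = 2 * T (j + 1) \<omega>" by (simp add: T_def)
        finally show ?thesis
          using Tj S_nonneg[OF \<omega>, of N] N1 by simp
      qed
      then show "\<exists>no. \<forall>N\<ge>no. norm ((\<Sum>k=1..N. g k \<omega>) / real N - 0) < e"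
        unfolding S_def by blast
    qed
  qed
qed

section \<open>The projected momentum iteration\<close>

text \<open>
The locale keeps the step sizes general; \<open>K\<^sup>2\<close> bounds the second moments of the stochastic gradients on
\<open>X\<close>, and \<open>B\<close> the means of all entries of all matrices. The random diagonal \<open>h n\<close> is not tied to the
samples before \<open>n\<close>: it may depend on the current sample, as it does when it is computed from the
current stochastic gradient. The initial point \<open>x0\<close> may lie outside \<open>X\<close>, so
statements about \<open>x n\<close> that need \<open>X\<close> are made for \<open>n \<ge> 1\<close>.
\<close>
locale adaptive_momentum_method = prob_space M for M :: "'w measure" +
  fixes \<xi> :: "'w \<Rightarrow> real ^ 'k" and \<xi>s :: "nat \<Rightarrow> 'w \<Rightarrow> real ^ 'k"
    and X :: "(real ^ 'd) set" and f :: "real ^ 'd \<Rightarrow> real"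
    and G :: "real ^ 'd \<Rightarrow> real ^ 'k \<Rightarrow> real ^ 'd"
    and \<alpha> \<beta> :: "nat \<Rightarrow> real" and \<gamma> l K B :: real
    and x0 m_init h0 :: "real ^ 'd" and x m dir h :: "nat \<Rightarrow> 'w \<Rightarrow> real ^ 'd"
  assumes X: "compact X" "convex X" "X \<noteq> {}"
    and f_convex: "convex_on UNIV f"
    and f_GDERIV: "\<And>y. GDERIV f y :> (\<integral>\<omega>. G y (\<xi> \<omega>) \<partial>M)"
    and \<xi>_measurable [measurable]: "\<xi> \<in> borel_measurable M"
    and \<xi>s_indep: "indep_vars (\<lambda>_. borel) \<xi>s UNIV"
    and \<xi>s_distr: "\<And>n. distr M borel (\<xi>s n) = distr M borel \<xi>"
    and G_measurable [measurable]: "(\<lambda>(y, s). G y s) \<in> borel_measurable (borel \<Otimes>\<^sub>M borel)"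
    and G_integrable: "\<And>y. integrable M (\<lambda>\<omega>. G y (\<xi> \<omega>))"
    and G_sq_integrable: "\<And>y. y \<in> X \<Longrightarrow> integrable M (\<lambda>\<omega>. (norm (G y (\<xi> \<omega>)))\<^sup>2)"
    and G_sq_le: "\<And>y. y \<in> X \<Longrightarrow> (\<integral>\<omega>. (norm (G y (\<xi> \<omega>)))\<^sup>2 \<partial>M) \<le> K\<^sup>2"
    and \<alpha>_pos: "\<And>n. n \<ge> 1 \<Longrightarrow> \<alpha> n > 0"
    and \<beta>_nonneg: "\<And>n. n \<ge> 1 \<Longrightarrow> 0 \<le> \<beta> n" and \<beta>_le: "\<And>n. n \<ge> 1 \<Longrightarrow> \<beta> n \<le> l ^ n"
    and l: "0 \<le> l" "l < 1"
    and \<gamma>: "0 \<le> \<gamma>" "\<gamma> < 1"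
    and h_mono: "\<And>n i. AE \<omega> in M. h n \<omega> $ i \<le> h (Suc n) \<omega> $ i"
    and h_integrable: "\<And>n i. integrable M (\<lambda>\<omega>. h n \<omega> $ i)"
    and h_mean_le: "\<And>n i. (\<integral>\<omega>. h n \<omega> $ i \<partial>M) \<le> B"
    and h_init: "\<And>\<omega>. \<omega> \<in> space M \<Longrightarrow> h 0 \<omega> = h0" and h0_pos: "\<And>i. h0 $ i > 0"
    and x_init: "\<And>\<omega>. \<omega> \<in> space M \<Longrightarrow> x 0 \<omega> = x0"
    and m_0: "\<And>\<omega>. \<omega> \<in> space M \<Longrightarrow>
        m 0 \<omega> = \<beta> 0 *\<^sub>R m_init + (1 - \<beta> 0) *\<^sub>R G (x 0 \<omega>) (\<xi>s 0 \<omega>)"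
    and m_Suc: "\<And>n \<omega>. \<omega> \<in> space M \<Longrightarrow>
        m (Suc n) \<omega> = \<beta> (Suc n) *\<^sub>R m n \<omega> + (1 - \<beta> (Suc n)) *\<^sub>R G (x (Suc n) \<omega>) (\<xi>s (Suc n) \<omega>)"
    and dir: "\<And>n \<omega>. \<omega> \<in> space M \<Longrightarrow>
        diag_matrix (h n \<omega>) *v dir n \<omega> = - ((1 / (1 - \<gamma> ^ (n + 1))) *\<^sub>R m n \<omega>)"
    and h_pos: "\<And>n \<omega> i. \<omega> \<in> space M \<Longrightarrow> h n \<omega> $ i > 0"
    and x_Suc: "\<And>n \<omega>. \<omega> \<in> space M \<Longrightarrow>
        x (Suc n) \<omega> = metric_proj X (diag_matrix (h n \<omega>)) (x n \<omega> + \<alpha> n *\<^sub>R dir n \<omega>)"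
    and x_adapted: "\<And>n. \<exists>\<phi> \<in> borel_measurable (Pi\<^sub>M {..<n} (\<lambda>_. borel)).
        \<forall>\<omega>\<in>space M. x n \<omega> = \<phi> (\<lambda>k\<in>{..<n}. \<xi>s k \<omega>)"
begin

lemma \<xi>s_measurable [measurable]: "\<xi>s n \<in> borel_measurable M"
  using \<xi>s_indep by (auto simp: indep_vars_def)

lemma
  shows x_measurable [measurable]: "x n \<in> borel_measurable M"
    and distr_x_\<xi>s: "distr M (borel \<Otimes>\<^sub>M borel) (\<lambda>\<omega>. (x n \<omega>, \<xi>s n \<omega>))
      = distr M borel (x n) \<Otimes>\<^sub>M distr M borel (\<xi>s n)"
proof -
  obtain \<phi> where "\<phi> \<in> borel_measurable (Pi\<^sub>M {..<n} (\<lambda>_. borel))"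
      "\<And>\<omega>. \<omega> \<in> space M \<Longrightarrow> x n \<omega> = \<phi> (\<lambda>k\<in>{..<n}. \<xi>s k \<omega>)"
    using x_adapted[of n] by blast
  note past = \<xi>s_indep this
  show "x n \<in> borel_measurable M" by (rule measurable_of_past[OF past])
  show "distr M (borel \<Otimes>\<^sub>M borel) (\<lambda>\<omega>. (x n \<omega>, \<xi>s n \<omega>))
      = distr M borel (x n) \<Otimes>\<^sub>M distr M borel (\<xi>s n)"
    by (rule distr_past_present[OF past])
qed

lemma x_in: "n \<ge> 1 \<Longrightarrow> \<omega> \<in> space M \<Longrightarrow> x n \<omega> \<in> X"
  using metric_proj_diag_in[OF X h_pos] x_Suc by (cases n) auto

lemma f_continuous: "continuous_on A f"
proof (rule differentiable_imp_continuous_on)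
  show "f differentiable_on A"
    unfolding differentiable_on_def
    using f_GDERIV by (auto simp: gderiv_def differentiable_def intro: has_derivative_at_withinI)
qed

lemma f_measurable [measurable]: "f \<in> borel_measurable borel"
  by (rule borel_measurable_continuous_onI[OF f_continuous])

lemma G_measurable_snd [measurable]: "G y \<in> borel_measurable borel"
  using measurable_compose[OF measurable_Pair1' G_measurable, of y] by simp

lemma nn_integral_\<xi>s:
  assumes [measurable]: "g \<in> borel_measurable borel"
  shows "(\<integral>\<^sup>+\<omega>. g (\<xi>s n \<omega>) \<partial>M) = (\<integral>\<^sup>+\<omega>. g (\<xi> \<omega>) \<partial>M)"
  using nn_integral_distr[of "\<xi>s n" M borel g] nn_integral_distr[of \<xi> M borel g]
  by (simp add: \<xi>s_distr)

lemma integral_\<xi>s: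
  fixes g :: "real ^ 'k \<Rightarrow> 'e :: {banach, second_countable_topology}"
  assumes [measurable]: "g \<in> borel_measurable borel"
  shows "(\<integral>\<omega>. g (\<xi>s n \<omega>) \<partial>M) = (\<integral>\<omega>. g (\<xi> \<omega>) \<partial>M)"
  using integral_distr[of "\<xi>s n" M borel g] integral_distr[of \<xi> M borel g]
  by (simp add: \<xi>s_distr)

lemma integrable_\<xi>s:
  fixes g :: "real ^ 'k \<Rightarrow> 'e :: {banach, second_countable_topology}"
  assumes [measurable]: "g \<in> borel_measurable borel"
  shows "integrable M (\<lambda>\<omega>. g (\<xi>s n \<omega>)) \<longleftrightarrow> integrable M (\<lambda>\<omega>. g (\<xi> \<omega>))"
  using integrable_distr_eq[of "\<xi>s n" M borel g] integrable_distr_eq[of \<xi> M borel g]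
  by (simp add: \<xi>s_distr)

definition sgrad :: "nat \<Rightarrow> 'w \<Rightarrow> real ^ 'd" where
  "sgrad n \<omega> = G (x n \<omega>) (\<xi>s n \<omega>)"

lemma sgrad_measurable [measurable]: "sgrad n \<in> borel_measurable M"
proof -
  have "(\<lambda>\<omega>. (x n \<omega>, \<xi>s n \<omega>)) \<in> M \<rightarrow>\<^sub>M (borel \<Otimes>\<^sub>M borel)" by measurable
  from measurable_compose[OF this G_measurable] show ?thesis
    by (simp add: sgrad_def[abs_def])
qed

text \<open>
The second-moment bound is assumed at deterministic points of \<open>X\<close>; since \<open>\<xi>s n\<close> is independent of \<open>x n\<close>,
it carries over to the random point \<open>x n\<close>.
\<close>
lemma
  assumes "n \<ge> 1"
  shows sgrad_sq_integrable: "integrable M (\<lambda>\<omega>. (norm (sgrad n \<omega>))\<^sup>2)"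
    and sgrad_sq_le: "(\<integral>\<omega>. (norm (sgrad n \<omega>))\<^sup>2 \<partial>M) \<le> K\<^sup>2"
proof -
  have [measurable]: "(\<lambda>p. ennreal ((norm (G (fst p) (snd p)))\<^sup>2)) \<in> borel_measurable (borel \<Otimes>\<^sub>M borel)"
    using G_measurable unfolding case_prod_beta by measurable
  have "(\<integral>\<^sup>+\<omega>. ennreal ((norm (sgrad n \<omega>))\<^sup>2) \<partial>M)
      = (\<integral>\<^sup>+\<omega>. (\<integral>\<^sup>+\<omega>'. ennreal ((norm (G (x n \<omega>) (\<xi>s n \<omega>')))\<^sup>2) \<partial>M) \<partial>M)"
    using nn_integral_product_distr[OF x_measurable \<xi>s_measurable distr_x_\<xi>s,
        of "\<lambda>p. ennreal ((norm (G (fst p) (snd p)))\<^sup>2)"]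
    by (simp add: sgrad_def)
  also have "\<dots> \<le> (\<integral>\<^sup>+\<omega>. ennreal (K\<^sup>2) \<partial>M)"
  proof (rule nn_integral_mono)
    fix \<omega> assume "\<omega> \<in> space M"
    then have xX: "x n \<omega> \<in> X" using x_in assms by simp
    have "(\<integral>\<^sup>+\<omega>'. ennreal ((norm (G (x n \<omega>) (\<xi>s n \<omega>')))\<^sup>2) \<partial>M)
        = (\<integral>\<^sup>+\<omega>'. ennreal ((norm (G (x n \<omega>) (\<xi> \<omega>')))\<^sup>2) \<partial>M)"
      by (rule nn_integral_\<xi>s) measurable
    also have "\<dots> \<le> ennreal (K\<^sup>2)"
      using G_sq_integrable[OF xX] G_sq_le[OF xX]
      by (subst nn_integral_eq_integral) (auto intro: ennreal_leI)
    finally show "(\<integral>\<^sup>+\<omega>'. ennreal ((norm (G (x n \<omega>) (\<xi>s n \<omega>')))\<^sup>2) \<partial>M) \<le> ennreal (K\<^sup>2)" .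
  qed
  also have "\<dots> = ennreal (K\<^sup>2)" by (simp add: emeasure_space_1)
  finally have le: "(\<integral>\<^sup>+\<omega>. ennreal ((norm (sgrad n \<omega>))\<^sup>2) \<partial>M) \<le> ennreal (K\<^sup>2)" .
  then show int: "integrable M (\<lambda>\<omega>. (norm (sgrad n \<omega>))\<^sup>2)"
    by (intro integrableI_nonneg) (auto intro: le_less_trans)
  show "(\<integral>\<omega>. (norm (sgrad n \<omega>))\<^sup>2 \<partial>M) \<le> K\<^sup>2"
    using le nn_integral_eq_integral[OF int] by (simp add: ennreal_le_iff)
qed

text \<open>
At \<open>n = 0\<close> the point is the constant \<open>x0\<close>, where the first moment is available even outside \<open>X\<close>.
\<close>
lemma sgrad_integrable: "integrable M (sgrad n)"
proof (cases n)
  case 0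
  have "integrable M (\<lambda>\<omega>. G x0 (\<xi>s 0 \<omega>))"
    using G_integrable integrable_\<xi>s[of "G x0"] by simp
  then show ?thesis
    unfolding 0 by (subst Bochner_Integration.integrable_cong[OF refl, where g = "\<lambda>\<omega>. G x0 (\<xi>s 0 \<omega>)"])
      (auto simp: sgrad_def x_init)
next
  case (Suc k)
  then show ?thesis using integrable_of_norm_sq[OF sgrad_measurable sgrad_sq_integrable] by simp
qed

lemma norm_x_diff_le:
  assumes "n \<ge> 1" "\<omega> \<in> space M" "z \<in> X"
  shows "norm (x n \<omega> - z) \<le> diameter X"
  using diameter_bounded_bound[OF compact_imp_bounded[OF X(1)] x_in[OF assms(1,2)] assms(3)]
  by (simp add: dist_norm)

lemma diameter_nonneg: "0 \<le> diameter X"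
  using diameter_ge_0[OF compact_imp_bounded[OF X(1)]] .

lemma inner_x_diff_integrable:
  assumes "integrable M u" "n \<ge> 1" "z \<in> X"
  shows "integrable M (\<lambda>\<omega>. u \<omega> \<bullet> (x n \<omega> - z))"
proof (rule Bochner_Integration.integrable_bound[of M "\<lambda>\<omega>. norm (u \<omega>) * diameter X"])
  show "integrable M (\<lambda>\<omega>. norm (u \<omega>) * diameter X)" using assms(1) by simp
  have [measurable]: "u \<in> borel_measurable M" using assms(1) by auto
  show "(\<lambda>\<omega>. u \<omega> \<bullet> (x n \<omega> - z)) \<in> borel_measurable M" by measurable
  show "AE \<omega> in M. norm (u \<omega> \<bullet> (x n \<omega> - z)) \<le> norm (norm (u \<omega>) * diameter X)"
  proof (rule AE_I2)
    fix \<omega> assume "\<omega> \<in> space M"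
    then have "norm (u \<omega>) * norm (x n \<omega> - z) \<le> norm (u \<omega>) * diameter X"
      using norm_x_diff_le assms(2,3) by (intro mult_left_mono) auto
    then show "norm (u \<omega> \<bullet> (x n \<omega> - z)) \<le> norm (norm (u \<omega>) * diameter X)"
      using Cauchy_Schwarz_ineq2[of "u \<omega>" "x n \<omega> - z"] diameter_nonneg by simp
  qed
qed

lemma integrable_f_iterates:
  assumes [measurable]: "u \<in> borel_measurable M" and u: "\<And>\<omega>. \<omega> \<in> space M \<Longrightarrow> u \<omega> \<in> X"
  shows "integrable M (\<lambda>\<omega>. f (u \<omega>))"
proof -
  have "bounded (f ` X)"
    by (intro compact_imp_bounded compact_continuous_image f_continuous X)
  then obtain b where "\<And>y. y \<in> X \<Longrightarrow> norm (f y) \<le> b" by (auto simp: bounded_iff)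
  then show ?thesis using u by (intro integrable_const_bound[of _ b]) auto
qed

text \<open>
Averaging over \<open>\<xi>s n\<close> with \<open>x n\<close> held fixed turns the stochastic gradient into the gradient of \<open>f\<close> at \<open>x n\<close>,
to which the gradient inequality for convex functions applies.
\<close>
lemma gap_le_mean_inner_sgrad:
  assumes "n \<ge> 1" "z \<in> X"
  shows "(\<integral>\<omega>. (f (x n \<omega>) - f z) \<partial>M) \<le> (\<integral>\<omega>. sgrad n \<omega> \<bullet> (x n \<omega> - z) \<partial>M)"
proof -
  let ?g = "\<lambda>p. G (fst p) (snd p) \<bullet> (fst p - z)"
  have [measurable]: "?g \<in> borel_measurable (borel \<Otimes>\<^sub>M borel)"
    using G_measurable unfolding case_prod_beta by measurable
  have int: "integrable M (\<lambda>\<omega>. ?g (x n \<omega>, \<xi>s n \<omega>))"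
    using inner_x_diff_integrable[OF sgrad_integrable assms] by (simp add: sgrad_def)
  have inner: "(\<integral>\<omega>'. ?g (x n \<omega>, \<xi>s n \<omega>') \<partial>M) = (\<integral>\<omega>'. G (x n \<omega>) (\<xi> \<omega>') \<partial>M) \<bullet> (x n \<omega> - z)" for \<omega>
  proof -
    have "(\<integral>\<omega>'. ?g (x n \<omega>, \<xi>s n \<omega>') \<partial>M) = (\<integral>\<omega>'. G (x n \<omega>) (\<xi> \<omega>') \<bullet> (x n \<omega> - z) \<partial>M)"
      using integral_\<xi>s[of "\<lambda>s. G (x n \<omega>) s \<bullet> (x n \<omega> - z)"] by simp
    then show ?thesis using G_integrable by simp
  qed
  have "(\<integral>\<omega>. (f (x n \<omega>) - f z) \<partial>M) \<le> (\<integral>\<omega>. (\<integral>\<omega>'. ?g (x n \<omega>, \<xi>s n \<omega>') \<partial>M) \<partial>M)"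
  proof (rule integral_mono)
    show "integrable M (\<lambda>\<omega>. f (x n \<omega>) - f z)"
      using x_in[OF assms(1)] assms(2) by (intro Bochner_Integration.integrable_diff integrable_f_iterates) auto
    show "integrable M (\<lambda>\<omega>. \<integral>\<omega>'. ?g (x n \<omega>, \<xi>s n \<omega>') \<partial>M)"
      by (rule integrable_integral_product_distr[OF x_measurable \<xi>s_measurable distr_x_\<xi>s _ int]) measurable
    show "f (x n \<omega>) - f z \<le> (\<integral>\<omega>'. ?g (x n \<omega>, \<xi>s n \<omega>') \<partial>M)" for \<omega>
      unfolding inner using convex_on_above_tangent_plane[OF f_convex f_GDERIV, of "x n \<omega>" z]
      by (simp add: inner_commute)
  qed
  also have "\<dots> = (\<integral>\<omega>. ?g (x n \<omega>, \<xi>s n \<omega>) \<partial>M)"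
    by (rule integral_product_distr[OF x_measurable \<xi>s_measurable distr_x_\<xi>s _ int, symmetric]) measurable
  finally show ?thesis by (simp add: sgrad_def)
qed

lemma m_integrable: "integrable M (m n)"
proof (induction n)
  case 0
  have "integrable M (\<lambda>\<omega>. \<beta> 0 *\<^sub>R m_init + (1 - \<beta> 0) *\<^sub>R sgrad 0 \<omega>)"
    using sgrad_integrable by simp
  then show ?case
    by (subst Bochner_Integration.integrable_cong[OF refl]) (auto simp: m_0 sgrad_def)
next
  case (Suc n)
  have "integrable M (\<lambda>\<omega>. \<beta> (Suc n) *\<^sub>R m n \<omega> + (1 - \<beta> (Suc n)) *\<^sub>R sgrad (Suc n) \<omega>)"
    using sgrad_integrable Suc by simp
  then show ?case
    by (subst Bochner_Integration.integrable_cong[OF refl]) (auto simp: m_Suc sgrad_def)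
qed

lemma m_measurable [measurable]: "m n \<in> borel_measurable M"
  using m_integrable by auto

text \<open>
Unrolling the momentum recursion gives \<open>m n = decay n *\<^sub>R m 0 + fresh n\<close>. The initial momentum \<open>m 0\<close>
involves the stochastic gradient at \<open>x0\<close>, whose second moment may be infinite, whereas \<open>fresh n\<close> is a
combination of stochastic gradients taken in \<open>X\<close>.
\<close>
definition decay :: "nat \<Rightarrow> real" where
  "decay n = (\<Prod>k=1..n. \<beta> k)"

definition fresh :: "nat \<Rightarrow> 'w \<Rightarrow> real ^ 'd" where
  "fresh n \<omega> = m n \<omega> - decay n *\<^sub>R m 0 \<omega>"

lemma fresh_measurable [measurable]: "fresh n \<in> borel_measurable M"
  unfolding fresh_def[abs_def] by measurable

lemma l_power_le: "n \<ge> 1 \<Longrightarrow> l ^ n \<le> l"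
  using l power_decreasing[of 1 n l] by simp

lemma \<beta>_le_l: "n \<ge> 1 \<Longrightarrow> \<beta> n \<le> l"
  using \<beta>_le l_power_le order_trans by blast

lemma decay_bounds: "0 \<le> decay n" "decay n \<le> l ^ n"
proof -
  show "0 \<le> decay n" unfolding decay_def using \<beta>_nonneg by (intro prod_nonneg) auto
  have "decay n \<le> (\<Prod>k=1..n. l)"
    unfolding decay_def using \<beta>_nonneg \<beta>_le_l by (intro prod_mono) auto
  then show "decay n \<le> l ^ n" by simp
qed

lemma fresh_Suc:
  assumes "\<omega> \<in> space M"
  shows "fresh (Suc n) \<omega> = \<beta> (Suc n) *\<^sub>R fresh n \<omega> + (1 - \<beta> (Suc n)) *\<^sub>R sgrad (Suc n) \<omega>"
  using assms by (simp add: fresh_def decay_def m_Suc sgrad_def algebra_simps)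

text \<open>
\<open>fresh\<close> starts at \<open>0\<close> and is updated by convex combinations with stochastic gradients, so convexity
of the squared norm preserves the bound \<open>K\<^sup>2\<close>.
\<close>
lemma
  shows fresh_sq_integrable: "integrable M (\<lambda>\<omega>. (norm (fresh n \<omega>))\<^sup>2)"
    and fresh_sq_le: "(\<integral>\<omega>. (norm (fresh n \<omega>))\<^sup>2 \<partial>M) \<le> K\<^sup>2"
proof -
  have "integrable M (\<lambda>\<omega>. (norm (fresh n \<omega>))\<^sup>2) \<and> (\<integral>\<omega>. (norm (fresh n \<omega>))\<^sup>2 \<partial>M) \<le> K\<^sup>2"
  proof (induction n)
    case 0
    then show ?case by (simp add: fresh_def decay_def)
  next
    case (Suc n)
    let ?b = "\<beta> (Suc n)"
    let ?g = "\<lambda>\<omega>. ?b * (norm (fresh n \<omega>))\<^sup>2 + (1 - ?b) * (norm (sgrad (Suc n) \<omega>))\<^sup>2"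
    have b: "0 \<le> ?b" "?b \<le> 1"
      using \<beta>_nonneg[of "Suc n"] \<beta>_le_l[of "Suc n"] l by auto
    have le: "(norm (fresh (Suc n) \<omega>))\<^sup>2 \<le> ?g \<omega>" if "\<omega> \<in> space M" for \<omega>
      unfolding fresh_Suc[OF that] by (rule norm_convex_combination_sq_le[OF b])
    have g: "integrable M ?g"
      using Suc sgrad_sq_integrable[of "Suc n"] by simp
    have int: "integrable M (\<lambda>\<omega>. (norm (fresh (Suc n) \<omega>))\<^sup>2)"
      using le by (intro Bochner_Integration.integrable_bound[OF g]) (auto intro!: AE_I2 intro: order_trans[OF _ abs_ge_self])
    have "(\<integral>\<omega>. (norm (fresh (Suc n) \<omega>))\<^sup>2 \<partial>M) \<le> (\<integral>\<omega>. ?g \<omega> \<partial>M)"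
      using le by (intro integral_mono int g) auto
    also have "\<dots> = ?b * (\<integral>\<omega>. (norm (fresh n \<omega>))\<^sup>2 \<partial>M) + (1 - ?b) * (\<integral>\<omega>. (norm (sgrad (Suc n) \<omega>))\<^sup>2 \<partial>M)"
      using Suc sgrad_sq_integrable[of "Suc n"] by simp
    also have "\<dots> \<le> ?b * K\<^sup>2 + (1 - ?b) * K\<^sup>2"
      using Suc sgrad_sq_le[of "Suc n"] b by (intro add_mono mult_left_mono) auto
    finally show ?case using int by (simp add: algebra_simps)
  qed
  then show "integrable M (\<lambda>\<omega>. (norm (fresh n \<omega>))\<^sup>2)" "(\<integral>\<omega>. (norm (fresh n \<omega>))\<^sup>2 \<partial>M) \<le> K\<^sup>2"
    by auto
qed

lemma mean_norm_m_le: "(\<integral>\<omega>. norm (m n \<omega>) \<partial>M) \<le> 1 + K\<^sup>2 + (\<integral>\<omega>. norm (m 0 \<omega>) \<partial>M)"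
proof -
  have "decay n \<le> 1" using decay_bounds(2)[of n] power_le_one[of l n] l by simp
  have le: "norm (m n \<omega>) \<le> 1 + (norm (fresh n \<omega>))\<^sup>2 + norm (m 0 \<omega>)" for \<omega>
  proof -
    have "norm (m n \<omega>) \<le> norm (fresh n \<omega>) + norm (decay n *\<^sub>R m 0 \<omega>)"
      using norm_triangle_ineq[of "fresh n \<omega>" "decay n *\<^sub>R m 0 \<omega>"] by (simp add: fresh_def)
    also have "norm (decay n *\<^sub>R m 0 \<omega>) \<le> norm (m 0 \<omega>)"
      using decay_bounds(1)[of n] \<open>decay n \<le> 1\<close> by (simp add: mult_left_le_one_le)
    finally show ?thesis using le_one_plus_square[of "norm (fresh n \<omega>)"] by linarith
  qed
  have "(\<integral>\<omega>. norm (m n \<omega>) \<partial>M) \<le> (\<integral>\<omega>. 1 + (norm (fresh n \<omega>))\<^sup>2 + norm (m 0 \<omega>) \<partial>M)"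
    using m_integrable fresh_sq_integrable le by (intro integral_mono) auto
  also have "\<dots> = 1 + (\<integral>\<omega>. (norm (fresh n \<omega>))\<^sup>2 \<partial>M) + (\<integral>\<omega>. norm (m 0 \<omega>) \<partial>M)"
    using m_integrable fresh_sq_integrable by (simp add: prob_space)
  finally show ?thesis using fresh_sq_le[of n] by simp
qed

definition h_min :: real where
  "h_min = Min (range (\<lambda>i. h0 $ i))"

lemma h_min_pos: "h_min > 0"
  unfolding h_min_def using h0_pos by (subst Min_gr_iff) auto

lemma AE_h_mono: "AE \<omega> in M. \<forall>n i. h n \<omega> $ i \<le> h (Suc n) \<omega> $ i"
  using h_mono by (simp add: AE_all_countable AE_finite_all)

lemma h_ge_h_min:
  assumes "\<forall>n i. h n \<omega> $ i \<le> h (Suc n) \<omega> $ i" "\<omega> \<in> space M"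
  shows "h_min \<le> h n \<omega> $ i"
proof (induction n)
  case 0
  then show ?case by (simp add: h_init[OF assms(2)] h_min_def)
next
  case (Suc n)
  then show ?case using assms(1) order_trans by blast
qed

lemma one_minus_\<gamma>_power: "1 - \<gamma> \<le> 1 - \<gamma> ^ (n + 1)" "1 - \<gamma> ^ (n + 1) \<le> 1"
    "1 - \<gamma> ^ (n + 1) \<le> 1 - \<gamma> ^ (Suc n + 1)"
proof -
  have "\<gamma> ^ (n + 1) \<le> \<gamma> ^ 1" "\<gamma> ^ (Suc n + 1) \<le> \<gamma> ^ (n + 1)"
    using \<gamma> by (intro power_decreasing; simp)+
  then show "1 - \<gamma> \<le> 1 - \<gamma> ^ (n + 1)" "1 - \<gamma> ^ (n + 1) \<le> 1 - \<gamma> ^ (Suc n + 1)" by simp_all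
  show "1 - \<gamma> ^ (n + 1) \<le> 1" using \<gamma> by simp
qed

text \<open>
\<open>preconditioned_step_le\<close> with \<open>p = fresh n\<close> and \<open>r = decay n *\<^sub>R m 0\<close>, followed by the expansion of
\<open>m n\<close> into the old momentum, whose share is at most \<open>l ^ n\<close>, and the current stochastic gradient.
The bias correction \<open>1 / (1 - \<gamma> ^ (n + 1))\<close> is treated as part of the step size.
\<close>
lemma one_step:
  assumes mono: "\<forall>n i. h n \<omega> $ i \<le> h (Suc n) \<omega> $ i" and \<omega>: "\<omega> \<in> space M"
    and n: "n \<ge> 1" and z: "z \<in> X"
  shows "2 * (1 - \<beta> n) * (sgrad n \<omega> \<bullet> (x n \<omega> - z))
     \<le> (1 - \<gamma> ^ (n + 1)) / \<alpha> n *
          (\<Sum>i\<in>UNIV. h n \<omega> $ i * (((x n \<omega> - z) $ i)\<^sup>2 - ((x (Suc n) \<omega> - z) $ i)\<^sup>2))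
       + 2 * diameter X * l ^ n * (norm (m 0 \<omega>) + norm (m (n - 1) \<omega>))
       + \<alpha> n / ((1 - \<gamma>) * h_min) * (norm (fresh n \<omega>))\<^sup>2"
proof -
  define \<kappa> where "\<kappa> = 1 - \<gamma> ^ (n + 1)"
  have \<kappa>: "\<kappa> > 0" "1 - \<gamma> \<le> \<kappa>" using one_minus_\<gamma>_power(1)[of n] \<gamma> by (auto simp: \<kappa>_def)
  have \<alpha>: "\<alpha> n > 0" using \<alpha>_pos n by simp
  have R: "0 \<le> diameter X" by (rule diameter_nonneg)
  define \<Phi> where
    "\<Phi> = (\<Sum>i\<in>UNIV. h n \<omega> $ i * (((x n \<omega> - z) $ i)\<^sup>2 - ((x (Suc n) \<omega> - z) $ i)\<^sup>2))"
  \<comment> \<open>rescaling the direction by \<open>\<kappa>\<close> removes the bias correction from it and turns the step size into \<open>\<alpha> n / \<kappa>\<close>\<close>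
  have "2 * ((fresh n \<omega> + decay n *\<^sub>R m 0 \<omega>) \<bullet> (x n \<omega> - z)) \<le> \<Phi> / (\<alpha> n / \<kappa>)
      + 2 * diameter X * norm (decay n *\<^sub>R m 0 \<omega>) + (\<alpha> n / \<kappa>) / h_min * (norm (fresh n \<omega>))\<^sup>2"
    unfolding \<Phi>_def
  proof (rule preconditioned_step_le[OF X])
    show "diag_matrix (h n \<omega>) *v (\<kappa> *\<^sub>R dir n \<omega>) = - (fresh n \<omega> + decay n *\<^sub>R m 0 \<omega>)"
      using \<kappa> dir[OF \<omega>, of n] by (simp add: matrix_vector_mult_scaleR fresh_def \<kappa>_def)
    show "x (Suc n) \<omega> = metric_proj X (diag_matrix (h n \<omega>)) (x n \<omega> + (\<alpha> n / \<kappa>) *\<^sub>R \<kappa> *\<^sub>R dir n \<omega>)"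
      using \<kappa> x_Suc[OF \<omega>] by simp
  qed (use h_ge_h_min[OF mono \<omega>] h_min_pos \<alpha> \<kappa> x_in n \<omega> z in auto)
  also have "fresh n \<omega> + decay n *\<^sub>R m 0 \<omega> = m n \<omega>" by (simp add: fresh_def)
  also have "\<Phi> / (\<alpha> n / \<kappa>) = \<kappa> / \<alpha> n * \<Phi>" by simp
  also have "2 * diameter X * norm (decay n *\<^sub>R m 0 \<omega>) \<le> 2 * diameter X * (l ^ n * norm (m 0 \<omega>))"
    using decay_bounds[of n] R by (intro mult_left_mono) (auto intro: mult_right_mono)
  also have "(\<alpha> n / \<kappa>) / h_min * (norm (fresh n \<omega>))\<^sup>2 \<le> \<alpha> n / ((1 - \<gamma>) * h_min) * (norm (fresh n \<omega>))\<^sup>2"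
    using \<alpha> \<kappa> \<gamma> h_min_pos by (intro mult_right_mono) (auto intro!: divide_left_mono)
  finally have m: "2 * (m n \<omega> \<bullet> (x n \<omega> - z)) \<le> \<kappa> / \<alpha> n * \<Phi>
      + 2 * diameter X * (l ^ n * norm (m 0 \<omega>)) + \<alpha> n / ((1 - \<gamma>) * h_min) * (norm (fresh n \<omega>))\<^sup>2"
    by simp
  have "m n \<omega> = \<beta> n *\<^sub>R m (n - 1) \<omega> + (1 - \<beta> n) *\<^sub>R sgrad n \<omega>"
    using m_Suc[OF \<omega>, of "n - 1"] n by (simp add: sgrad_def)
  then have "m n \<omega> \<bullet> (x n \<omega> - z)
      = \<beta> n * (m (n - 1) \<omega> \<bullet> (x n \<omega> - z)) + (1 - \<beta> n) * (sgrad n \<omega> \<bullet> (x n \<omega> - z))"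
    by (simp add: inner_add_left)
  moreover have "- (\<beta> n * (m (n - 1) \<omega> \<bullet> (x n \<omega> - z))) \<le> diameter X * (l ^ n * norm (m (n - 1) \<omega>))"
  proof -
    have "- (m (n - 1) \<omega> \<bullet> (x n \<omega> - z)) \<le> norm (m (n - 1) \<omega>) * norm (x n \<omega> - z)"
      using Cauchy_Schwarz_ineq2[of "m (n - 1) \<omega>" "x n \<omega> - z"] by linarith
    also have "\<dots> \<le> norm (m (n - 1) \<omega>) * diameter X"
      using norm_x_diff_le[OF n \<omega> z] by (rule mult_left_mono) simp
    finally have "\<beta> n * - (m (n - 1) \<omega> \<bullet> (x n \<omega> - z)) \<le> \<beta> n * (norm (m (n - 1) \<omega>) * diameter X)"
      using \<beta>_nonneg[OF n] by (rule mult_left_mono)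
    also have "\<dots> \<le> l ^ n * (norm (m (n - 1) \<omega>) * diameter X)"
      using \<beta>_le[OF n] R by (intro mult_right_mono) auto
    finally show ?thesis by (simp add: mult_ac)
  qed
  ultimately show ?thesis
    using m unfolding \<kappa>_def \<Phi>_def by (simp add: algebra_simps)
qed

text \<open>
In each coordinate \<open>i\<close> the decrements of \<open>((x n - z) $ i)\<^sup>2\<close> carry the coefficient
\<open>w n (1 - \<gamma> ^ (n + 1)) (h n $ i) / \<alpha> n\<close>, a product of nonnegative nondecreasing sequences. So
\<open>sum_weighted_decrements_le\<close> applies, and only the coefficient at \<open>N\<close> remains.
\<close>
lemma weighted_sum_pathwise:
  assumes w: "\<And>n. n \<ge> 1 \<Longrightarrow> w n \<ge> 0"
    and w_mono: "\<And>n. n \<ge> 1 \<Longrightarrow> w n / \<alpha> n \<le> w (Suc n) / \<alpha> (Suc n)"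
    and mono: "\<forall>n i. h n \<omega> $ i \<le> h (Suc n) \<omega> $ i" and \<omega>: "\<omega> \<in> space M"
    and N: "N \<ge> 1" and z: "z \<in> X"
  shows "(\<Sum>n=1..N. w n * (2 * (1 - \<beta> n) * (sgrad n \<omega> \<bullet> (x n \<omega> - z))))
    \<le> (diameter X)\<^sup>2 * (w N / \<alpha> N) * (\<Sum>i\<in>UNIV. h N \<omega> $ i)
      + (\<Sum>n=1..N. w n * (2 * diameter X * l ^ n * (norm (m 0 \<omega>) + norm (m (n - 1) \<omega>))
          + \<alpha> n / ((1 - \<gamma>) * h_min) * (norm (fresh n \<omega>))\<^sup>2))"
proof -
  define a where "a \<equiv> \<lambda>n. w n / \<alpha> n * (1 - \<gamma> ^ (n + 1))"
  have \<gamma>0: "0 \<le> 1 - \<gamma> ^ (n + 1)" for n using one_minus_\<gamma>_power(1)[of n] \<gamma> by linarith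
  have w\<alpha>: "0 \<le> w n / \<alpha> n" if "n \<ge> 1" for n using w \<alpha>_pos that by (simp add: less_imp_le)
  have a_nonneg: "0 \<le> a n" if "n \<ge> 1" for n
    unfolding a_def using w\<alpha>[OF that] \<gamma>0[of n] by (rule mult_nonneg_nonneg)
  have a_mono: "a n \<le> a (Suc n)" if "n \<ge> 1" for n
    unfolding a_def using w_mono[OF that] one_minus_\<gamma>_power(3)[of n] w\<alpha>[of "Suc n"] \<gamma>0[of n]
    by (intro mult_mono) auto
  let ?u = "\<lambda>i n. ((x n \<omega> - z) $ i)\<^sup>2"
  have u_le: "?u i n \<le> (diameter X)\<^sup>2" if "n \<ge> 1" for i n
  proof -
    have "\<bar>(x n \<omega> - z) $ i\<bar> \<le> diameter X"
      using component_le_norm_cart[of "x n \<omega> - z" i] norm_x_diff_le[OF that \<omega> z] by linarith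
    then show ?thesis using diameter_nonneg by (simp add: abs_le_square_iff[symmetric])
  qed
  have coord: "(\<Sum>n=1..N. (a n * h n \<omega> $ i) * (?u i n - ?u i (Suc n))) \<le> (diameter X)\<^sup>2 * (a N * h N \<omega> $ i)" for i
  proof (rule sum_weighted_decrements_le[OF N])
    show "0 \<le> a 1 * h 1 \<omega> $ i" using a_nonneg[of 1] h_pos[OF \<omega>, of 1 i] by simp
    show "a n * h n \<omega> $ i \<le> a (Suc n) * h (Suc n) \<omega> $ i" if "n \<ge> 1" for n
      using a_mono[OF that] mono a_nonneg[of "Suc n"] h_pos[OF \<omega>, of n i] by (intro mult_mono) auto
  qed (use u_le in auto)
  have "(\<Sum>n=1..N. w n * ((1 - \<gamma> ^ (n + 1)) / \<alpha> n * (\<Sum>i\<in>UNIV. h n \<omega> $ i * (?u i n - ?u i (Suc n)))))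
      = (\<Sum>n=1..N. \<Sum>i\<in>UNIV. (a n * h n \<omega> $ i) * (?u i n - ?u i (Suc n)))"
    by (simp add: a_def sum_distrib_left mult_ac)
  also have "\<dots> = (\<Sum>i\<in>UNIV. \<Sum>n=1..N. (a n * h n \<omega> $ i) * (?u i n - ?u i (Suc n)))"
    by (rule sum.swap)
  also have "\<dots> \<le> (\<Sum>i\<in>UNIV. (diameter X)\<^sup>2 * (a N * h N \<omega> $ i))"
    by (intro sum_mono coord)
  also have "\<dots> = (diameter X)\<^sup>2 * a N * (\<Sum>i\<in>UNIV. h N \<omega> $ i)"
    unfolding sum_distrib_left by (intro sum.cong) (auto simp: mult_ac)
  also have "\<dots> \<le> (diameter X)\<^sup>2 * (w N / \<alpha> N) * (\<Sum>i\<in>UNIV. h N \<omega> $ i)"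
  proof (intro mult_right_mono mult_left_mono)
    show "a N \<le> w N / \<alpha> N"
      unfolding a_def using w\<alpha>[OF N] one_minus_\<gamma>_power(2)[of N] by (rule mult_left_le[rotated])
    show "0 \<le> (\<Sum>i\<in>UNIV. h N \<omega> $ i)"
      using h_pos[OF \<omega>] by (intro sum_nonneg) (auto intro: less_imp_le)
  qed auto
  finally have main: "(\<Sum>n=1..N. w n * ((1 - \<gamma> ^ (n + 1)) / \<alpha> n * (\<Sum>i\<in>UNIV. h n \<omega> $ i * (?u i n - ?u i (Suc n)))))
      \<le> (diameter X)\<^sup>2 * (w N / \<alpha> N) * (\<Sum>i\<in>UNIV. h N \<omega> $ i)" .
  have "(\<Sum>n=1..N. w n * (2 * (1 - \<beta> n) * (sgrad n \<omega> \<bullet> (x n \<omega> - z))))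
    \<le> (\<Sum>n=1..N. w n * ((1 - \<gamma> ^ (n + 1)) / \<alpha> n * (\<Sum>i\<in>UNIV. h n \<omega> $ i * (?u i n - ?u i (Suc n)))
        + (2 * diameter X * l ^ n * (norm (m 0 \<omega>) + norm (m (n - 1) \<omega>))
          + \<alpha> n / ((1 - \<gamma>) * h_min) * (norm (fresh n \<omega>))\<^sup>2)))"
    using one_step[OF mono \<omega> _ z] w by (intro sum_mono mult_left_mono) (auto simp: add.assoc)
  also have "\<dots> = (\<Sum>n=1..N. w n * ((1 - \<gamma> ^ (n + 1)) / \<alpha> n * (\<Sum>i\<in>UNIV. h n \<omega> $ i * (?u i n - ?u i (Suc n)))))
      + (\<Sum>n=1..N. w n * (2 * diameter X * l ^ n * (norm (m 0 \<omega>) + norm (m (n - 1) \<omega>))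
          + \<alpha> n / ((1 - \<gamma>) * h_min) * (norm (fresh n \<omega>))\<^sup>2))"
    by (simp only: distrib_left sum.distrib)
  finally show ?thesis using main by linarith
qed

text \<open>
The mean of \<open>weighted_sum_pathwise\<close>. Because \<open>z\<close> is a minimizer, the mean gaps are nonnegative, and the
factors \<open>1 - \<beta> n\<close> can be replaced by their common lower bound \<open>1 - l\<close>.
\<close>
lemma weighted_sum_mean:
  assumes w: "\<And>n. n \<ge> 1 \<Longrightarrow> w n \<ge> 0"
    and w_mono: "\<And>n. n \<ge> 1 \<Longrightarrow> w n / \<alpha> n \<le> w (Suc n) / \<alpha> (Suc n)"
    and N: "N \<ge> 1" and z: "z \<in> X" and z_min: "\<And>y. y \<in> X \<Longrightarrow> f z \<le> f y"
  shows "2 * (1 - l) * (\<Sum>n=1..N. w n * (\<integral>\<omega>. (f (x n \<omega>) - f z) \<partial>M))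
    \<le> (diameter X)\<^sup>2 * (w N / \<alpha> N) * (real CARD('d) * B)
      + (\<Sum>n=1..N. w n * (2 * diameter X * l ^ n * (1 + K\<^sup>2 + 2 * (\<integral>\<omega>. norm (m 0 \<omega>) \<partial>M))
          + \<alpha> n / ((1 - \<gamma>) * h_min) * K\<^sup>2))"
proof -
  let ?Z = "\<integral>\<omega>. norm (m 0 \<omega>) \<partial>M"
  have L: "0 \<le> \<alpha> n / ((1 - \<gamma>) * h_min)" if "n \<ge> 1" for n
    using \<alpha>_pos[OF that] \<gamma> h_min_pos by simp
  let ?lhs = "\<lambda>\<omega>. \<Sum>n=1..N. w n * (2 * (1 - \<beta> n) * (sgrad n \<omega> \<bullet> (x n \<omega> - z)))"
  let ?err = "\<lambda>n \<omega>. 2 * diameter X * l ^ n * (norm (m 0 \<omega>) + norm (m (n - 1) \<omega>))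
          + \<alpha> n / ((1 - \<gamma>) * h_min) * (norm (fresh n \<omega>))\<^sup>2"
  let ?rhs = "\<lambda>\<omega>. (diameter X)\<^sup>2 * (w N / \<alpha> N) * (\<Sum>i\<in>UNIV. h N \<omega> $ i) + (\<Sum>n=1..N. w n * ?err n \<omega>)"
  have err_int: "integrable M (?err n)" for n
    using m_integrable fresh_sq_integrable by (intro Bochner_Integration.integrable_add integrable_mult_right) auto
  have err_le: "(\<integral>\<omega>. ?err n \<omega> \<partial>M) \<le> 2 * diameter X * l ^ n * (1 + K\<^sup>2 + 2 * ?Z) + \<alpha> n / ((1 - \<gamma>) * h_min) * K\<^sup>2"
    if n: "n \<ge> 1" for n
  proof -
    have "(\<integral>\<omega>. ?err n \<omega> \<partial>M) = 2 * diameter X * l ^ n * (?Z + (\<integral>\<omega>. norm (m (n - 1) \<omega>) \<partial>M))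
        + \<alpha> n / ((1 - \<gamma>) * h_min) * (\<integral>\<omega>. (norm (fresh n \<omega>))\<^sup>2 \<partial>M)"
      using m_integrable fresh_sq_integrable by simp
    also have "\<dots> \<le> 2 * diameter X * l ^ n * (1 + K\<^sup>2 + 2 * ?Z) + \<alpha> n / ((1 - \<gamma>) * h_min) * K\<^sup>2"
    proof (rule add_mono[OF mult_left_mono mult_left_mono[OF fresh_sq_le L[OF n]]])
      show "?Z + (\<integral>\<omega>. norm (m (n - 1) \<omega>) \<partial>M) \<le> 1 + K\<^sup>2 + 2 * ?Z"
        using mean_norm_m_le[of "n - 1"] by simp
    qed (use diameter_nonneg l in auto)
    finally show ?thesis .
  qed
  have lhs_int: "integrable M ?lhs"
    using inner_x_diff_integrable[OF sgrad_integrable _ z]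
    by (intro Bochner_Integration.integrable_sum integrable_mult_right) auto
  have h_int: "integrable M (\<lambda>\<omega>. \<Sum>i\<in>UNIV. h N \<omega> $ i)"
    using h_integrable by (intro Bochner_Integration.integrable_sum) auto
  have rhs_int: "integrable M ?rhs"
    by (rule Bochner_Integration.integrable_add[OF integrable_mult_right[OF h_int]
          Bochner_Integration.integrable_sum[OF integrable_mult_right[OF err_int]]])
  have "2 * (1 - l) * (\<Sum>n=1..N. w n * (\<integral>\<omega>. (f (x n \<omega>) - f z) \<partial>M))
      = (\<Sum>n=1..N. w n * (2 * (1 - l) * (\<integral>\<omega>. (f (x n \<omega>) - f z) \<partial>M)))"
    by (simp add: sum_distrib_left mult_ac)
  also have "\<dots> \<le> (\<Sum>n=1..N. w n * (2 * (1 - \<beta> n) * (\<integral>\<omega>. sgrad n \<omega> \<bullet> (x n \<omega> - z) \<partial>M)))"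
  proof (rule sum_mono, rule mult_left_mono)
    fix n assume "n \<in> {1..N}"
    then have n: "n \<ge> 1" by simp
    show "0 \<le> w n" by (rule w[OF n])
    have "0 \<le> (\<integral>\<omega>. (f (x n \<omega>) - f z) \<partial>M)"
      using z_min x_in[OF n] by (intro Bochner_Integration.integral_nonneg_AE AE_I2) auto
    then show "2 * (1 - l) * (\<integral>\<omega>. (f (x n \<omega>) - f z) \<partial>M)
        \<le> 2 * (1 - \<beta> n) * (\<integral>\<omega>. sgrad n \<omega> \<bullet> (x n \<omega> - z) \<partial>M)"
      using gap_le_mean_inner_sgrad[OF n z] \<beta>_le_l[OF n] l by (intro mult_mono) auto
  qed
  also have "\<dots> = (\<integral>\<omega>. ?lhs \<omega> \<partial>M)"
    using inner_x_diff_integrable[OF sgrad_integrable _ z]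
    by (subst Bochner_Integration.integral_sum) auto
  also have "\<dots> \<le> (\<integral>\<omega>. ?rhs \<omega> \<partial>M)"
  proof (rule integral_mono_AE[OF lhs_int rhs_int])
    show "AE \<omega> in M. ?lhs \<omega> \<le> ?rhs \<omega>"
      using AE_h_mono
    proof (rule AE_mp, intro AE_I2 impI)
      fix \<omega> assume "\<omega> \<in> space M" "\<forall>n i. h n \<omega> $ i \<le> h (Suc n) \<omega> $ i"
      then show "?lhs \<omega> \<le> ?rhs \<omega>"
        by (intro weighted_sum_pathwise w w_mono N z)
    qed
  qed
  also have "\<dots> = (diameter X)\<^sup>2 * (w N / \<alpha> N) * (\<Sum>i\<in>UNIV. \<integral>\<omega>. h N \<omega> $ i \<partial>M)
      + (\<Sum>n=1..N. w n * (\<integral>\<omega>. ?err n \<omega> \<partial>M))"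
  proof -
    have "(\<integral>\<omega>. ?rhs \<omega> \<partial>M) = (diameter X)\<^sup>2 * (w N / \<alpha> N) * (\<integral>\<omega>. (\<Sum>i\<in>UNIV. h N \<omega> $ i) \<partial>M)
        + (\<integral>\<omega>. (\<Sum>n=1..N. w n * ?err n \<omega>) \<partial>M)"
    proof -
      have "integrable M (\<lambda>\<omega>. (diameter X)\<^sup>2 * (w N / \<alpha> N) * (\<Sum>i\<in>UNIV. h N \<omega> $ i))"
        by (intro integrable_mult_right h_int)
      moreover have "integrable M (\<lambda>\<omega>. \<Sum>n=1..N. w n * ?err n \<omega>)"
        by (intro Bochner_Integration.integrable_sum integrable_mult_right err_int)
      ultimately show ?thesis
        by (simp only: Bochner_Integration.integral_add integral_mult_right_zero)
    qed
    moreover have "(\<integral>\<omega>. (\<Sum>i\<in>UNIV. h N \<omega> $ i) \<partial>M) = (\<Sum>i\<in>UNIV. \<integral>\<omega>. h N \<omega> $ i \<partial>M)"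
      using h_integrable by (intro Bochner_Integration.integral_sum)
    moreover have "(\<integral>\<omega>. (\<Sum>n=1..N. w n * ?err n \<omega>) \<partial>M) = (\<Sum>n=1..N. w n * (\<integral>\<omega>. ?err n \<omega> \<partial>M))"
      using err_int
      by (subst Bochner_Integration.integral_sum)
        (rule integrable_mult_right, simp, simp only: integral_mult_right_zero)
    ultimately show ?thesis by simp
  qed
  also have "\<dots> \<le> (diameter X)\<^sup>2 * (w N / \<alpha> N) * (real CARD('d) * B)
      + (\<Sum>n=1..N. w n * (2 * diameter X * l ^ n * (1 + K\<^sup>2 + 2 * ?Z) + \<alpha> n / ((1 - \<gamma>) * h_min) * K\<^sup>2))"
  proof (intro add_mono mult_left_mono sum_mono)
    show "(\<Sum>i\<in>UNIV. \<integral>\<omega>. h N \<omega> $ i \<partial>M) \<le> real CARD('d) * B"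
      using h_mean_le sum_bounded_above[of UNIV "\<lambda>i. \<integral>\<omega>. h N \<omega> $ i \<partial>M" B] by simp
    show "0 \<le> (diameter X)\<^sup>2 * (w N / \<alpha> N)"
      using w[OF N] \<alpha>_pos[OF N] by simp
  qed (use err_le w in auto)
  finally show ?thesis .
qed

text \<open>One constant for the three error terms of \<open>weighted_sum_mean\<close>.\<close>
definition gap_const :: real where
  "gap_const = ((diameter X)\<^sup>2 * (real CARD('d) * B)
      + 2 * diameter X * (1 + K\<^sup>2 + 2 * (\<integral>\<omega>. norm (m 0 \<omega>) \<partial>M))
      + K\<^sup>2 / ((1 - \<gamma>) * h_min)) / (2 * (1 - l))"

lemma B_nonneg: "0 \<le> B"
proof -
  have "0 \<le> (\<integral>\<omega>. h 0 \<omega> $ i \<partial>M)" for i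
    using h_pos by (intro Bochner_Integration.integral_nonneg_AE AE_I2) (simp add: less_imp_le)
  then show ?thesis using h_mean_le[of 0] order_trans by blast
qed

lemma gap_const_nonneg: "0 \<le> gap_const"
  using diameter_nonneg B_nonneg \<gamma> h_min_pos l by (simp add: gap_const_def)

text \<open>
Both conclusions about the mean gaps are instances: the weights \<open>w = \<alpha>\<close> make the first term constant,
the weights \<open>w = 1\<close> bound the plain sum of the gaps.
\<close>
lemma weighted_gap_bound:
  assumes w: "\<And>n. n \<ge> 1 \<Longrightarrow> w n \<ge> 0"
    and w_mono: "\<And>n. n \<ge> 1 \<Longrightarrow> w n / \<alpha> n \<le> w (Suc n) / \<alpha> (Suc n)"
    and N: "N \<ge> 1" and z: "z \<in> X" and z_min: "\<And>y. y \<in> X \<Longrightarrow> f z \<le> f y"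
  shows "(\<Sum>n=1..N. w n * (\<integral>\<omega>. (f (x n \<omega>) - f z) \<partial>M))
    \<le> gap_const * (w N / \<alpha> N + (\<Sum>n=1..N. w n * l ^ n) + (\<Sum>n=1..N. w n * \<alpha> n))"
proof -
  define C1 where "C1 = (diameter X)\<^sup>2 * (real CARD('d) * B)"
  define C2 where "C2 = 2 * diameter X * (1 + K\<^sup>2 + 2 * (\<integral>\<omega>. norm (m 0 \<omega>) \<partial>M))"
  define C3 where "C3 = K\<^sup>2 / ((1 - \<gamma>) * h_min)"
  have C: "0 \<le> C1" "0 \<le> C2" "0 \<le> C3"
    using diameter_nonneg B_nonneg \<gamma> h_min_pos by (auto simp: C1_def C2_def C3_def)
  define a b c where "a = w N / \<alpha> N" and "b = (\<Sum>n=1..N. w n * l ^ n)" and "c = (\<Sum>n=1..N. w n * \<alpha> n)"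
  have abc: "0 \<le> a" "0 \<le> b" "0 \<le> c"
    unfolding a_def b_def c_def using w \<alpha>_pos N l
    by (auto intro!: sum_nonneg divide_nonneg_pos mult_nonneg_nonneg intro: less_imp_le)
  have "(\<Sum>n=1..N. w n * (2 * diameter X * l ^ n * (1 + K\<^sup>2 + 2 * (\<integral>\<omega>. norm (m 0 \<omega>) \<partial>M))
        + \<alpha> n / ((1 - \<gamma>) * h_min) * K\<^sup>2)) = (\<Sum>n=1..N. C2 * (w n * l ^ n) + C3 * (w n * \<alpha> n))"
    by (intro sum.cong) (simp_all add: C2_def C3_def distrib_left mult_ac)
  then have "2 * (1 - l) * (\<Sum>n=1..N. w n * (\<integral>\<omega>. (f (x n \<omega>) - f z) \<partial>M))
      \<le> C1 * a + C2 * b + C3 * c"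
    using weighted_sum_mean[OF w w_mono N z z_min]
    by (simp add: C1_def a_def b_def c_def sum_distrib_left sum.distrib mult_ac)
  also have "\<dots> \<le> (C1 + C2 + C3) * (a + b + c)"
  proof -
    have "0 \<le> C1 * b + C1 * c + C2 * a + C2 * c + C3 * a + C3 * b" using C abc by simp
    then show ?thesis by (simp add: algebra_simps)
  qed
  also have "C1 + C2 + C3 = 2 * (1 - l) * gap_const"
    using l by (simp add: gap_const_def C1_def C2_def C3_def)
  finally have "2 * (1 - l) * (\<Sum>n=1..N. w n * (\<integral>\<omega>. (f (x n \<omega>) - f z) \<partial>M))
      \<le> 2 * (1 - l) * (gap_const * (a + b + c))" by (simp only: mult.assoc)
  then show ?thesis
    using l unfolding a_def b_def c_def by (subst (asm) mult_le_cancel_left_pos) auto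
qed

section \<open>Convergence of the iterates and of their averages\<close>

lemma f_attains_min:
  obtains z where "z \<in> X" "\<And>y. y \<in> X \<Longrightarrow> f z \<le> f y"
  using continuous_attains_inf[OF X(1,3) f_continuous] by blast

lemma mean_gap_nonneg:
  assumes "\<And>y. y \<in> X \<Longrightarrow> f z \<le> f y" "n \<ge> 1"
  shows "0 \<le> (\<integral>\<omega>. (f (x n \<omega>) - f z) \<partial>M)"
  using assms x_in[of n] by (intro Bochner_Integration.integral_nonneg_AE AE_I2) auto

text \<open>
With the weights \<open>\<alpha>\<close> the bound is finite, so \<open>\<alpha> n\<close> times the mean gap is summable. Mean gaps that
eventually exceed some \<open>e > 0\<close> would then make \<open>\<alpha>\<close> itself summable.
\<close>
lemma liminf_mean_gap:
  assumes sq: "summable (\<lambda>n. (\<alpha> n)\<^sup>2)" and div: "\<not> summable \<alpha>"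
    and z: "z \<in> X" "\<And>y. y \<in> X \<Longrightarrow> f z \<le> f y"
  shows "liminf (\<lambda>n. ereal (\<integral>\<omega>. (f (x n \<omega>) - f z) \<partial>M)) = 0"
proof -
  define g where "g \<equiv> \<lambda>n. \<integral>\<omega>. (f (x n \<omega>) - f z) \<partial>M"
  have g: "0 \<le> g n" if "n \<ge> 1" for n
    unfolding g_def by (rule mean_gap_nonneg[OF z(2) that])
  have \<alpha>0: "0 \<le> \<alpha> n" if "n \<ge> 1" for n using \<alpha>_pos[OF that] by simp
  define S where "S = (\<Sum>n. (\<alpha> n)\<^sup>2)"
  have \<alpha>\<alpha>: "(\<Sum>n=1..N. \<alpha> n * \<alpha> n) \<le> S" for N
    unfolding S_def using sum_le_suminf[OF sq, of "{1..N}"] by (simp add: power2_eq_square)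
  have \<alpha>l: "(\<Sum>n=1..N. \<alpha> n * l ^ n) \<le> S + 1 / (1 - l)" for N
  proof -
    have "(\<Sum>n=1..N. \<alpha> n * l ^ n) \<le> (\<Sum>n=1..N. \<alpha> n * \<alpha> n + l ^ n)"
    proof (rule sum_mono)
      fix n
      have "2 * (\<alpha> n * l ^ n) \<le> \<alpha> n * \<alpha> n + l ^ n * l ^ n"
        using sum_squares_bound[of "\<alpha> n" "l ^ n"] by (simp only: power2_eq_square mult.assoc)
      moreover have "0 \<le> \<alpha> n * \<alpha> n" by simp
      moreover have "0 \<le> l ^ n" "l ^ n \<le> 1" using l by (auto intro: power_le_one)
      then have "l ^ n * l ^ n \<le> l ^ n" "0 \<le> l ^ n" by (auto intro: mult_left_le)
      ultimately show "\<alpha> n * l ^ n \<le> \<alpha> n * \<alpha> n + l ^ n"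
        by linarith
    qed
    then show ?thesis
      using \<alpha>\<alpha>[of N] sum_geometric_le[OF l, of N] by (simp add: sum.distrib)
  qed
  have partial: "(\<Sum>n<N. \<alpha> (Suc n) * g (Suc n)) \<le> gap_const * (1 + (S + 1 / (1 - l)) + S)" for N
  proof (cases "N = 0")
    case True
    have "0 \<le> S" unfolding S_def using sq by (intro suminf_nonneg) auto
    then show ?thesis using True gap_const_nonneg l by simp
  next
    case False
    have "(\<Sum>n=1..N. \<alpha> n * g n)
        \<le> gap_const * (\<alpha> N / \<alpha> N + (\<Sum>n=1..N. \<alpha> n * l ^ n) + (\<Sum>n=1..N. \<alpha> n * \<alpha> n))"
      unfolding g_def
    proof (rule weighted_gap_bound)
      show "\<alpha> n / \<alpha> n \<le> \<alpha> (Suc n) / \<alpha> (Suc n)" if "n \<ge> 1" for n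
        using \<alpha>_pos[OF that] \<alpha>_pos[of "Suc n"] by simp
    qed (use \<alpha>0 z False in auto)
    also have "\<dots> \<le> gap_const * (1 + (S + 1 / (1 - l)) + S)"
      using \<alpha>\<alpha>[of N] \<alpha>l[of N] \<alpha>_pos[of N] False gap_const_nonneg by (intro mult_left_mono add_mono) auto
    finally show ?thesis by (simp add: sum.atLeast1_atMost_eq)
  qed
  have "summable (\<lambda>n. \<alpha> (Suc n) * g (Suc n))"
    using \<alpha>0 g partial by (intro summableI_nonneg_bounded) auto
  then have sum_g: "summable (\<lambda>n. \<alpha> n * g n)" by (subst (asm) summable_Suc_iff)
  have "\<not> 0 < liminf (\<lambda>n. ereal (g n))"
  proof
    assume "0 < liminf (\<lambda>n. ereal (g n))"
    then obtain e where e: "0 < ereal e" "ereal e < liminf (\<lambda>n. ereal (g n))"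
      using ereal_dense2 by blast
    have "\<forall>\<^sub>F n in sequentially. norm (\<alpha> n) \<le> \<alpha> n * g n / e"
      using less_LiminfD[OF e(2)] eventually_ge_at_top[of 1]
    proof eventually_elim
      case (elim n)
      then have "\<alpha> n * e \<le> \<alpha> n * g n" using \<alpha>0 by (intro mult_left_mono) auto
      then show ?case using e(1) elim \<alpha>0[of n] by (simp add: field_simps)
    qed
    then have "summable \<alpha>"
      by (rule summable_comparison_test_ev) (intro summable_divide sum_g)
    with div show False by contradiction
  qed
  moreover have "0 \<le> liminf (\<lambda>n. ereal (g n))"
    using g by (intro Liminf_bounded) (auto intro!: eventually_sequentiallyI[of 1])
  ultimately show ?thesis unfolding g_def by simp
qed

lemma sum_mean_gap_le:
  assumes \<alpha>: "\<And>n. n \<ge> 1 \<Longrightarrow> \<alpha> n = 1 / real n powr \<eta>" and \<eta>: "1/2 \<le> \<eta>"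
    and z: "z \<in> X" "\<And>y. y \<in> X \<Longrightarrow> f z \<le> f y"
    and N: "N \<ge> 1"
  shows "(\<Sum>n=1..N. \<integral>\<omega>. (f (x n \<omega>) - f z) \<partial>M) \<le> gap_const * (3 + 1 / (1 - l)) * real N powr \<eta>"
proof -
  have "(\<Sum>n=1..N. 1 * (\<integral>\<omega>. (f (x n \<omega>) - f z) \<partial>M))
      \<le> gap_const * (1 / \<alpha> N + (\<Sum>n=1..N. 1 * l ^ n) + (\<Sum>n=1..N. 1 * \<alpha> n))"
  proof (rule weighted_gap_bound)
    show "1 / \<alpha> n \<le> 1 / \<alpha> (Suc n)" if "n \<ge> 1" for n
      using that \<eta> by (simp add: \<alpha> powr_mono2)
  qed (use z N in auto)
  also have "\<dots> \<le> gap_const * (real N powr \<eta> + 1 / (1 - l) * real N powr \<eta> + 2 * real N powr \<eta>)"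
  proof (intro mult_left_mono add_mono gap_const_nonneg)
    show "1 / \<alpha> N \<le> real N powr \<eta>" using N by (simp add: \<alpha>)
    have "1 \<le> real N powr \<eta>" using N \<eta> by (intro ge_one_powr_ge_zero) auto
    then have "1 / (1 - l) * 1 \<le> 1 / (1 - l) * real N powr \<eta>"
      using l by (intro mult_left_mono) auto
    then show "(\<Sum>n=1..N. 1 * l ^ n) \<le> 1 / (1 - l) * real N powr \<eta>"
      using sum_geometric_le[OF l, of N] by simp
    show "(\<Sum>n=1..N. 1 * \<alpha> n) \<le> 2 * real N powr \<eta>"
      using sum_powr_minus_le[OF \<eta>, of N] by (simp add: \<alpha>)
  qed
  finally show ?thesis
    by (simp add: algebra_simps)
qed

lemma averaged_measurable [measurable]: "(\<lambda>\<omega>. averaged (\<lambda>k. x k \<omega>) n) \<in> borel_measurable M"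
  unfolding averaged_def by measurable

lemma gap_averaged_le:
  assumes "n \<ge> 1"
  shows "f (averaged (\<lambda>k. x k \<omega>) n) - f z \<le> (\<Sum>k=1..n. f (x k \<omega>) - f z) / real n"
  using convex_on_averaged_le[OF f_convex assms, of "\<lambda>k. x k \<omega>"] assms
  by (simp add: sum_subtractf diff_divide_distrib)

text \<open>
Almost surely the averaged gaps tend to \<open>0\<close>, and by Jensen's inequality they dominate the gap at the averaged
iterate. Hence \<open>f\<close> takes its minimum at each accumulation point.
\<close>
lemma averaged_accumulation_points:
  assumes \<alpha>: "\<And>n. n \<ge> 1 \<Longrightarrow> \<alpha> n = 1 / real n powr \<eta>" and \<eta>: "1/2 \<le> \<eta>" "\<eta> < 1"
  shows "AE \<omega> in M. \<forall>a. accumulation_point (averaged (\<lambda>k. x k \<omega>)) a \<longrightarrow> a \<in> VI_solutions X f"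
proof -
  obtain z where z: "z \<in> X" "\<And>y. y \<in> X \<Longrightarrow> f z \<le> f y" using f_attains_min by blast
  let ?C = "gap_const * (3 + 1 / (1 - l))"
  have "AE \<omega> in M. (\<lambda>N. (\<Sum>k=1..N. f (x k \<omega>) - f z) / real N) \<longlonglongrightarrow> 0"
  proof (rule averages_tendsto_zero_AE)
    show "integrable M (\<lambda>\<omega>. f (x k \<omega>) - f z)" if "k \<ge> 1" for k
      using x_in[OF that] z(1) by (intro Bochner_Integration.integrable_diff integrable_f_iterates) auto
    show "0 \<le> f (x k \<omega>) - f z" if "k \<ge> 1" "\<omega> \<in> space M" for k \<omega>
      using z(2)[OF x_in[OF that]] by simp
    show "0 < 1 - \<eta>" using \<eta> by simp
    show "(\<Sum>k=1..N. \<integral>\<omega>. (f (x k \<omega>) - f z) \<partial>M) \<le> ?C * real N powr (1 - (1 - \<eta>))" if "N \<ge> 1" for N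
      using sum_mean_gap_le[OF \<alpha> \<eta>(1) z that] by simp
  qed
  then show ?thesis
  proof (rule AE_mp, intro AE_I2 impI allI)
    fix \<omega> a
    assume \<omega>: "\<omega> \<in> space M" and lim: "(\<lambda>N. (\<Sum>k=1..N. f (x k \<omega>) - f z) / real N) \<longlonglongrightarrow> 0"
      and acc: "accumulation_point (averaged (\<lambda>k. x k \<omega>)) a"
    let ?a = "averaged (\<lambda>k. x k \<omega>)"
    have aX: "?a n \<in> X" if "n \<ge> 1" for n
      using x_in \<omega> by (intro averaged_in_convex X that)
    have "(\<lambda>n. f (?a n) - f z) \<longlonglongrightarrow> 0"
    proof (rule tendsto_sandwich[OF _ _ tendsto_const lim])
      show "\<forall>\<^sub>F n in sequentially. 0 \<le> f (?a n) - f z"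
        using z(2) aX by (intro eventually_sequentiallyI[of 1]) simp
      show "\<forall>\<^sub>F n in sequentially. f (?a n) - f z \<le> (\<Sum>k=1..n. f (x k \<omega>) - f z) / real n"
        using gap_averaged_le by (intro eventually_sequentiallyI[of 1]) simp
    qed
    then have fa: "(\<lambda>n. f (?a n)) \<longlonglongrightarrow> f z" by (simp add: LIM_zero_iff)
    obtain r where r: "strict_mono r" "(\<lambda>n. ?a (r n)) \<longlonglongrightarrow> a"
      using acc by (auto simp: accumulation_point_def o_def)
    have r1: "r n \<ge> 1" if "n \<ge> 1" for n
      using seq_suble[OF r(1), of n] that by simp
    have "a \<in> X"
      using aX r1 by (intro Lim_in_closed_set[OF compact_imp_closed[OF X(1)] _ _ r(2)])
        (auto intro!: eventually_sequentiallyI[of 1])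
    have "isCont f a"
      using f_continuous[of UNIV] by (simp add: continuous_on_eq_continuous_at)
    then have "(\<lambda>n. f (?a (r n))) \<longlonglongrightarrow> f a"
      using r(2) by (rule isCont_tendsto_compose)
    moreover have "(\<lambda>n. f (?a (r n))) \<longlonglongrightarrow> f z"
      using LIMSEQ_subseq_LIMSEQ[OF fa r(1)] by (simp add: o_def)
    ultimately have "f a = f z" by (rule LIMSEQ_unique)
    then show "a \<in> VI_solutions X f"
      using z(2) by (intro minimizer_in_VI_solutions[OF X(2) \<open>a \<in> X\<close> _ f_GDERIV]) simp
  qed
qed

lemma averaged_rate:
  assumes \<alpha>: "\<And>n. n \<ge> 1 \<Longrightarrow> \<alpha> n = 1 / real n powr \<eta>" and \<eta>: "1/2 \<le> \<eta>"
  shows "(\<lambda>n. \<integral>\<omega>. (f (averaged (\<lambda>k. x k \<omega>) n) - optimal_value X f) \<partial>M)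
          \<in> O(\<lambda>n. 1 / real n powr (1 - \<eta>))"
proof -
  obtain z where z: "z \<in> X" "\<And>y. y \<in> X \<Longrightarrow> f z \<le> f y" using f_attains_min by blast
  let ?C = "gap_const * (3 + 1 / (1 - l))"
  have opt: "optimal_value X f = f z" by (rule optimal_value_eq) (use z in auto)
  show ?thesis
    unfolding opt
  proof (rule bigoI, rule eventually_sequentiallyI)
    fix n :: nat assume n: "n \<ge> 1"
    have aX: "averaged (\<lambda>k. x k \<omega>) n \<in> X" if "\<omega> \<in> space M" for \<omega>
      using x_in that by (intro averaged_in_convex X n)
    have x_int: "integrable M (\<lambda>\<omega>. f (x k \<omega>) - f z)" if "k \<in> {1..n}" for k
      using x_in[of k] that z(1) by (intro Bochner_Integration.integrable_diff integrable_f_iterates) auto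
    have nonneg: "0 \<le> (\<integral>\<omega>. (f (averaged (\<lambda>k. x k \<omega>) n) - f z) \<partial>M)"
      using z(2) aX by (intro Bochner_Integration.integral_nonneg_AE AE_I2) simp
    have "(\<integral>\<omega>. (f (averaged (\<lambda>k. x k \<omega>) n) - f z) \<partial>M)
        \<le> (\<integral>\<omega>. (\<Sum>k=1..n. f (x k \<omega>) - f z) / real n \<partial>M)"
    proof (rule integral_mono)
      show "integrable M (\<lambda>\<omega>. f (averaged (\<lambda>k. x k \<omega>) n) - f z)"
        using aX z(1) by (intro Bochner_Integration.integrable_diff integrable_f_iterates) auto
      show "integrable M (\<lambda>\<omega>. (\<Sum>k=1..n. f (x k \<omega>) - f z) / real n)"
        by (intro integrable_divide Bochner_Integration.integrable_sum x_int)
    qed (rule gap_averaged_le[OF n])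
    also have "\<dots> = (\<Sum>k=1..n. \<integral>\<omega>. (f (x k \<omega>) - f z) \<partial>M) / real n"
      unfolding integral_divide_zero
      by (subst Bochner_Integration.integral_sum) (rule x_int, simp_all)
    also have "\<dots> \<le> ?C * real n powr \<eta> / real n"
      using sum_mean_gap_le[OF \<alpha> \<eta> z n] by (intro divide_right_mono) auto
    also have "\<dots> = ?C * (1 / real n powr (1 - \<eta>))"
      using n by (simp add: powr_diff)
    finally show "norm (\<integral>\<omega>. (f (averaged (\<lambda>k. x k \<omega>) n) - f z) \<partial>M)
        \<le> ?C * norm (1 / real n powr (1 - \<eta>))"
      using nonneg by simp
  qed
qed

end

section \<open>Convergence for polynomially decaying step sizes\<close>

theorem proposition3p2:
  fixes M :: "'w measure"
    and \<xi> :: "'w \<Rightarrow> real ^ 'k"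
    and \<Xi> :: "(real ^ 'k) set"
    and \<xi>s :: "nat \<Rightarrow> 'w \<Rightarrow> real ^ 'k"
    and X :: "(real ^ 'd) set"
    and F :: "real ^ 'd \<Rightarrow> real ^ 'k \<Rightarrow> real"
    and f :: "real ^ 'd \<Rightarrow> real"
    and G :: "real ^ 'd \<Rightarrow> real ^ 'k \<Rightarrow> real ^ 'd"
    and \<alpha> \<beta> :: "nat \<Rightarrow> real"
    and \<gamma> \<eta> l :: real
    and x0 m_init h0 :: "real ^ 'd"
    and x m mhat dir h :: "nat \<Rightarrow> 'w \<Rightarrow> real ^ 'd"
  assumes prob: "prob_space M"
    and xi_rv: "\<xi> \<in> borel_measurable M"
    and xi_supp: "AE s in distr M borel \<xi>. s \<in> \<Xi>"
    \<comment> \<open>(A1)\<close>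
    and A1: "X \<noteq> {}" "closed X" "convex X"
    \<comment> \<open>(A2)\<close>
    and A2_well_defined: "\<And>y. integrable M (\<lambda>\<omega>. F y (\<xi> \<omega>))"
    and A2_f: "\<And>y. f y = (\<integral>\<omega>. F y (\<xi> \<omega>) \<partial>M)"
    and A2_C1: "AE s in distr M borel \<xi>. s \<in> \<Xi> \<longrightarrow> continuously_differentiable (\<lambda>y. F y s)"
    \<comment> \<open>(A3)\<close>
    and A3: "\<And>n i. AE \<omega> in M. h (Suc n) \<omega> $ i \<ge> h n \<omega> $ i"
    \<comment> \<open>(A4)\<close>
    and A4_integrable: "\<And>n i. integrable M (\<lambda>\<omega>. h n \<omega> $ i)"
    and A4: "\<And>i. \<exists>B::real. B > 0 \<and> (SUP n. ereal (\<integral>\<omega>. h n \<omega> $ i \<partial>M)) \<le> ereal B"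
    \<comment> \<open>(A5)\<close>
    and A5: "(MAX i. SUP (y, z)\<in>X \<times> X. ereal ((y $ i - z $ i)\<^sup>2)) < \<infinity>"
    \<comment> \<open>(C1)\<close>
    and C1_indep: "prob_space.indep_vars M (\<lambda>_. borel) \<xi>s UNIV"
    and C1_distr: "\<And>n. distr M borel (\<xi>s n) = distr M borel \<xi>"
    \<comment> \<open>(C2)\<close>
    and C2_measurable: "(\<lambda>(y, s). G y s) \<in> borel_measurable (borel \<Otimes>\<^sub>M borel)"
    and C2_integrable: "\<And>y. integrable M (\<lambda>\<omega>. G y (\<xi> \<omega>))"
    and C2: "\<And>y. GDERIV f y :> (\<integral>\<omega>. G y (\<xi> \<omega>) \<partial>M)"
    \<comment> \<open>(C3)\<close>
    and C3: "\<exists>K::real. K > 0 \<and> (\<forall>y\<in>X. integrable M (\<lambda>\<omega>. (norm (G y (\<xi> \<omega>)))\<^sup>2) \<and>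
                 (\<integral>\<omega>. (norm (G y (\<xi> \<omega>)))\<^sup>2 \<partial>M) \<le> K\<^sup>2)"
    and F_convex: "AE s in distr M borel \<xi>. s \<in> \<Xi> \<longrightarrow> convex_on UNIV (\<lambda>y. F y s)"
    \<comment> \<open>parameters\<close>
    and eta: "1/2 \<le> \<eta>" "\<eta> \<le> 1"
    and lambda: "0 < l" "l < 1"
    and alpha0: "0 < \<alpha> 0" "\<alpha> 0 < 1"
    and alpha: "\<And>n. n \<ge> 1 \<Longrightarrow> \<alpha> n = 1 / real n powr \<eta>"
    and beta0: "0 \<le> \<beta> 0" "\<beta> 0 < 1"
    and beta: "\<And>n. n \<ge> 1 \<Longrightarrow> \<beta> n = l ^ n"
    and gamma: "0 \<le> \<gamma>" "\<gamma> < 1"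
    \<comment> \<open>the algorithm; the diagonal matrices are given by their diagonals h\<close>
    and h_init: "\<And>\<omega>. \<omega> \<in> space M \<Longrightarrow> h 0 \<omega> = h0"
    and h_pos: "\<And>n \<omega> i. \<omega> \<in> space M \<Longrightarrow> h n \<omega> $ i > 0"
    and x_init: "\<And>\<omega>. \<omega> \<in> space M \<Longrightarrow> x 0 \<omega> = x0"
    and m_0: "\<And>\<omega>. \<omega> \<in> space M \<Longrightarrow>
        m 0 \<omega> = \<beta> 0 *\<^sub>R m_init + (1 - \<beta> 0) *\<^sub>R G (x 0 \<omega>) (\<xi>s 0 \<omega>)"
    and m_Suc: "\<And>n \<omega>. \<omega> \<in> space M \<Longrightarrow>
        m (Suc n) \<omega> = \<beta> (Suc n) *\<^sub>R m n \<omega> + (1 - \<beta> (Suc n)) *\<^sub>R G (x (Suc n) \<omega>) (\<xi>s (Suc n) \<omega>)"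
    and mhat: "\<And>n \<omega>. \<omega> \<in> space M \<Longrightarrow> mhat n \<omega> = (1 / (1 - \<gamma> ^ (n + 1))) *\<^sub>R m n \<omega>"
    and dir: "\<And>n \<omega>. \<omega> \<in> space M \<Longrightarrow> diag_matrix (h n \<omega>) *v dir n \<omega> = - mhat n \<omega>"
    and x_Suc: "\<And>n \<omega>. \<omega> \<in> space M \<Longrightarrow>
        x (Suc n) \<omega> = metric_proj X (diag_matrix (h n \<omega>)) (x n \<omega> + \<alpha> n *\<^sub>R dir n \<omega>)"
    and x_adapted: "\<And>n. \<exists>\<phi> \<in> borel_measurable (Pi\<^sub>M {..<n} (\<lambda>_. borel)).
        \<forall>\<omega>\<in>space M. x n \<omega> = \<phi> (\<lambda>k\<in>{..<n}. \<xi>s k \<omega>)"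
  shows
    "(\<eta> > 1/2 \<longrightarrow>
        liminf (\<lambda>n. ereal (\<integral>\<omega>. (f (x n \<omega>) - optimal_value X f) \<partial>M)) = 0) \<and>
     (\<eta> < 1 \<longrightarrow>
        (AE \<omega> in M. \<forall>z. accumulation_point (averaged (\<lambda>k. x k \<omega>)) z \<longrightarrow> z \<in> VI_solutions X f) \<and>
        (\<lambda>n. \<integral>\<omega>. (f (averaged (\<lambda>k. x k \<omega>) n) - optimal_value X f) \<partial>M)
          \<in> O(\<lambda>n. 1 / real n powr (1 - \<eta>)))"
proof -
  interpret prob_space M by (rule prob)
  \<comment> \<open>integrating the convexity inequality of \<open>F\<close> at fixed points and a fixed weight\<close>
  have f_convex: "convex_on UNIV f"
  proof (rule convex_onI)
    fix t :: real and y z :: "real ^ 'd" assume t: "0 < t" "t < 1"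
    have "AE \<omega> in M. \<xi> \<omega> \<in> \<Xi>" "AE \<omega> in M. \<xi> \<omega> \<in> \<Xi> \<longrightarrow> convex_on UNIV (\<lambda>y. F y (\<xi> \<omega>))"
      using AE_distrD[OF xi_rv xi_supp] AE_distrD[OF xi_rv F_convex] by simp_all
    then have "AE \<omega> in M. F ((1 - t) *\<^sub>R y + t *\<^sub>R z) (\<xi> \<omega>)
        \<le> (1 - t) * F y (\<xi> \<omega>) + t * F z (\<xi> \<omega>)"
    proof eventually_elim
      case (elim \<omega>)
      then have "convex_on UNIV (\<lambda>y. F y (\<xi> \<omega>))" by simp
      from convex_onD[OF this, of t y z] t show ?case by simp
    qed
    then have "f ((1 - t) *\<^sub>R y + t *\<^sub>R z)
        \<le> (\<integral>\<omega>. (1 - t) * F y (\<xi> \<omega>) + t * F z (\<xi> \<omega>) \<partial>M)"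
      unfolding A2_f using A2_well_defined by (intro integral_mono_AE) auto
    also have "\<dots> = (1 - t) * f y + t * f z"
      unfolding A2_f using A2_well_defined by simp
    finally show "f ((1 - t) *\<^sub>R y + t *\<^sub>R z) \<le> (1 - t) * f y + t * f z" .
  qed simp
  \<comment> \<open>the squared coordinate differences to one point of \<open>X\<close> are bounded, hence so is \<open>X\<close>\<close>
  have "bounded X"
  proof -
    define S where "S \<equiv> \<lambda>i. SUP (y, z)\<in>X \<times> X. ereal ((y $ i - z $ i)\<^sup>2)"
    obtain z where z: "z \<in> X" using A1(1) by blast
    have "S i < \<infinity>" for i
    proof -
      have "S i \<le> (MAX i. S i)" by (intro Max_ge) auto
      then show ?thesis using A5 unfolding S_def by (rule le_less_trans)
    qed
    moreover have S: "ereal ((y $ i - z $ i)\<^sup>2) \<le> S i" if "y \<in> X" for y i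
      unfolding S_def using z that by (intro SUP_upper2[of "(y, z)"]) auto
    moreover have "0 \<le> S i" for i
      using S[OF z, of i] by (simp add: zero_ereal_def)
    ultimately have fin: "S i = ereal (real_of_ereal (S i))" for i
      by (metis ereal_real ereal_infty_less(1) ereal_less_eq(2) PInfty_neq_ereal(1) abs_ereal_ge0 less_irrefl)
    have comp: "\<bar>(y - z) $ i\<bar> \<le> 1 + real_of_ereal (S i)" if "y \<in> X" for y i
    proof -
      have "(y $ i - z $ i)\<^sup>2 \<le> real_of_ereal (S i)"
        using S[OF that, of i] by (subst (asm) fin) simp
      then show ?thesis
        using le_one_plus_square[of "\<bar>(y - z) $ i\<bar>"] by simp
    qed
    have "norm y \<le> norm z + (\<Sum>i\<in>UNIV. 1 + real_of_ereal (S i))" if "y \<in> X" for y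
    proof -
      have "norm y \<le> norm z + norm (y - z)" by (rule norm_triangle_sub)
      also have "norm (y - z) \<le> (\<Sum>i\<in>UNIV. \<bar>(y - z) $ i\<bar>)" by (rule norm_le_l1_cart)
      also have "\<dots> \<le> (\<Sum>i\<in>UNIV. 1 + real_of_ereal (S i))" by (intro sum_mono comp that)
      finally show ?thesis by simp
    qed
    then show ?thesis by (auto simp: bounded_iff)
  qed
  then have X_compact: "compact X" using A1(2) by (simp add: compact_eq_bounded_closed)
  obtain K where K: "\<And>y. y \<in> X \<Longrightarrow> integrable M (\<lambda>\<omega>. (norm (G y (\<xi> \<omega>)))\<^sup>2)"
      "\<And>y. y \<in> X \<Longrightarrow> (\<integral>\<omega>. (norm (G y (\<xi> \<omega>)))\<^sup>2 \<partial>M) \<le> K\<^sup>2"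
    using C3 by blast
  obtain B where B: "\<And>i n. (\<integral>\<omega>. h n \<omega> $ i \<partial>M) \<le> B"
  proof -
    obtain b where b: "\<And>i. (SUP n. ereal (\<integral>\<omega>. h n \<omega> $ i \<partial>M)) \<le> ereal (b i)"
      using A4 by metis
    have "(\<integral>\<omega>. h n \<omega> $ i \<partial>M) \<le> Max (range b)" for i n
    proof -
      have "ereal (\<integral>\<omega>. h n \<omega> $ i \<partial>M) \<le> ereal (b i)"
        using b[of i] by (rule order_trans[rotated]) (rule SUP_upper, simp)
      then have "(\<integral>\<omega>. h n \<omega> $ i \<partial>M) \<le> b i" by simp
      also have "b i \<le> Max (range b)" by (intro Max_ge) auto
      finally show ?thesis .
    qed
    then show thesis by (rule that)
  qed
  \<comment> \<open>a probability space has a point, at which the initial diagonal is \<open>h0\<close>\<close>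
  have h0_pos: "h0 $ i > 0" for i
  proof -
    obtain \<omega> where "\<omega> \<in> space M" using not_empty by blast
    then show ?thesis using h_init h_pos[of \<omega> 0 i] by simp
  qed
  interpret adaptive_momentum_method M \<xi> \<xi>s X f G \<alpha> \<beta> \<gamma> l K B x0 m_init h0 x m dir h
  proof unfold_locales
    show "\<alpha> n > 0" if "n \<ge> 1" for n using alpha that by simp
    show "0 \<le> \<beta> n" "\<beta> n \<le> l ^ n" if "n \<ge> 1" for n using beta[OF that] lambda by simp_all
    show "diag_matrix (h n \<omega>) *v dir n \<omega> = - ((1 / (1 - \<gamma> ^ (n + 1))) *\<^sub>R m n \<omega>)"
      if "\<omega> \<in> space M" for n \<omega> using dir[OF that] mhat[OF that] by simp
  qed (fact X_compact A1 f_convex C2 xi_rv C1_indep C1_distr C2_measurable C2_integrable K gamma A3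
      A4_integrable B h_init h0_pos x_init m_0 m_Suc h_pos x_Suc x_adapted
      | use lambda in simp)+
  obtain z where z: "z \<in> X" "\<And>y. y \<in> X \<Longrightarrow> f z \<le> f y" using f_attains_min by blast
  have opt: "optimal_value X f = f z" by (rule optimal_value_eq) (use z in auto)
  show ?thesis
  proof (intro conjI impI)
    assume \<eta>: "1/2 < \<eta>"
    have powr_eq: "1 / real n powr p = real n powr - p" for n p by (simp add: powr_minus_divide)
    have "summable (\<lambda>n. (\<alpha> n)\<^sup>2)"
    proof (subst summable_cong)
      show "\<forall>\<^sub>F n in sequentially. (\<alpha> n)\<^sup>2 = real n powr (- (2 * \<eta>))"
        by (intro eventually_sequentiallyI[of 1])
          (simp add: alpha powr_eq power2_eq_square powr_add [symmetric])
    qed (use \<eta> in \<open>simp add: summable_real_powr_iff\<close>)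
    moreover have "\<not> summable \<alpha>"
    proof (subst summable_cong)
      show "\<forall>\<^sub>F n in sequentially. \<alpha> n = real n powr (- \<eta>)"
        by (intro eventually_sequentiallyI[of 1]) (simp add: alpha powr_eq)
    qed (use eta in \<open>simp add: summable_real_powr_iff\<close>)
    ultimately show "liminf (\<lambda>n. ereal (\<integral>\<omega>. (f (x n \<omega>) - optimal_value X f) \<partial>M)) = 0"
      unfolding opt using z by (intro liminf_mean_gap) auto
  next
    assume "\<eta> < 1"
    then show "AE \<omega> in M. \<forall>z. accumulation_point (averaged (\<lambda>k. x k \<omega>)) z \<longrightarrow> z \<in> VI_solutions X f"
      using averaged_accumulation_points[OF alpha eta(1)] by blast
  next
    show "(\<lambda>n. \<integral>\<omega>. (f (averaged (\<lambda>k. x k \<omega>) n) - optimal_value X f) \<partial>M)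
          \<in> O(\<lambda>n. 1 / real n powr (1 - \<eta>))"
      using averaged_rate[OF alpha eta(1)] by blast
  qed
qed

end
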